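(* Let $R$ be a complete Noetherian local ring, and let $p$ be a pair operation on a class $\mathcal{P}$ of pairs of Matlis-dualizable $R$-modules, with dual pair operation $p^{\smile}$ on $\mathcal{P}^\vee$. Then: (1) $(p^{\smile})^{\smile} = p$. (2) If $p$ is extensive, then $p^{\smile}$ is intensive. (3) If $p$ is intensive, then $p^{\smile}$ is extensive. (4) $p$ is order-preserving on submodules if and only if $p^{\smile}$ is. (5) $p$ is idempotent if and only if $p^{\smile}$ is. (6) If $p$ is a closure operation, then $p^{\smile}$ is an interior operation. (7) If $p$ is an interior operation, then $p^{\smile}$ is a closure operation. (8) $p$ is restrictable if and only if $p^{\smile}$ is surjection-functorial. (9) Assume $p$ is order-preserving on submodules. Then $p$ is functorial if and only if $p^{\smile}$ is.
   Context: Let $(R,\mathfrak{m},k)$ be a complete Noetherian local ring, $E=E_R(k)$ the injective hull of $k$, and $(-)^\vee=\mathrm{Hom}_R(-,E)$. A module $M$ is Matlis-dualizable if the natural map $M\to M^{\vee\vee}$ is an isomorphism; one then identifies $M^{\vee\vee}$ with $M$. For $A\subseteq B$, the module $(B/A)^\vee$ is regarded as a submodule of $B^\vee$ via the dual of $B\twoheadrightarrow B/A$. Let $\mathcal{P}$ be a collection of pairs $(L,M)$ with $L$ a submodule of $M$, closed under isomorphism (if $\phi:M\to M'$ is an isomorphism and $(L,M)\in\mathcal{P}$ then $(\phi(L),M')\in\mathcal{P}$). A pair operation on $\mathcal{P}$ is a function $p$ sending each $(L,M)\in\mathcal{P}$ to a submodule $p(L,M)$ of $M$ such that $\phi(p(L,M))=p(\phi(L),M')$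 for every isomorphism $\phi:M\to M'$ and every $(L,M)\in\mathcal{P}$. The pair operation $p$ is: - idempotent if $p(p(L,M),M)=p(L,M)$ whenever $(L,M),(p(L,M),M)\in\mathcal{P}$; - extensive if $L\subseteq p(L,M)$ always; intensive if $p(L,M)\subseteq L$ always; - order-preserving on submodules if $p(L,M)\subseteq p(N,M)$ whenever $L\subseteq N\subseteq M$ and $(L,M),(N,M)\in\mathcal{P}$; - surjection-functorial if $\pi(p(L,M))\subseteq p(\pi(L),M')$ whenever $\pi:M\twoheadrightarrow M'$ is surjective and $(L,M),(\pi(L),M')\in\mathcal{P}$; - functorial if $g(p(L,M))\subseteq p(g(L),M')$ whenever $g:M\to M'$ is $R$-linear and $(L,M),(g(L),M')\in\mathcal{P}$; - restrictable if $p(L\cap N,N)\subseteq p(L,M)$ whenever $L,N\subseteq M$ and $(L\cap N,N),(L,M)\in\mathcal{P}$; - a closure operation if it is extensive, order-preserving on submodules and idempotent; - a (relative) interior operation if it is intensive, order-preserving on submodules and idempotent. Dual: $\mathcal{P}^\vee:=\{(A,B) : ((B/A)^\vee,B^\vee)\in\mathcal{P}\}$, and for $(A,B)\in\mathcal{P}^\vee$, $$p^{\smile}(A,B):=\left(\frac{B^\vee}{p\left((B/A)^\vee,B^\vee\right)}\right)^\vee,$$ regarded as a submodule of $B^{\vee\vee}=B$. One has $(\mathcal{P}^\vee)^\vee=\mathcal{P}$.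
   Formalization: Item (9), false for arbitrary P, is proved assuming also that for each R-linear g: M→M', P contains (g(g⁻¹(L')),M') whenever it contains (g⁻¹(L'),M) and (L',M'), and (g⁻¹(g(L)),M) whenever it contains (L,M) and (g(L),M'). *)

theory Defs
  imports "HOL-Algebra.Algebra"
begin

section \<open>Modules over a commutative ring\<close>

definition mod_hom ::
  "('r, 'x) ring_scheme \<Rightarrow> ('r, 'a, 'y) module_scheme \<Rightarrow> ('r, 'b, 'z) module_scheme \<Rightarrow> ('a \<Rightarrow> 'b) set"
  where "mod_hom R M N =
    {f \<in> carrier M \<rightarrow> carrier N.
       (\<forall>x\<in>carrier M. \<forall>y\<in>carrier M. f (x \<oplus>\<^bsub>M\<^esub> y) = f x \<oplus>\<^bsub>N\<^esub> f y) \<and>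
       (\<forall>r\<in>carrier R. \<forall>x\<in>carrier M. f (r \<odot>\<^bsub>M\<^esub> x) = r \<odot>\<^bsub>N\<^esub> f x)}"

definition mod_iso ::
  "('r, 'x) ring_scheme \<Rightarrow> ('r, 'a, 'y) module_scheme \<Rightarrow> ('r, 'b, 'z) module_scheme \<Rightarrow> ('a \<Rightarrow> 'b) set"
  where "mod_iso R M N = {f \<in> mod_hom R M N. bij_betw f (carrier M) (carrier N)}"

text \<open>The record type of modules extends that of rings; the multiplicative fields play no role
  for modules, and are left undefined below.\<close>

definition self_module :: "('r, 'x) ring_scheme \<Rightarrow> ('r, 'r) module"
  where "self_module R =
    \<lparr>carrier = carrier R, monoid.mult = undefined, monoid.one = undefined,
     ring.zero = \<zero>\<^bsub>R\<^esub>, ring.add = ring.add R,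
     smult = monoid.mult R\<rparr>"

definition quot_module :: "('r, 'a, 'y) module_scheme \<Rightarrow> 'a set \<Rightarrow> ('r, 'a set) module"
  where "quot_module M N =
    \<lparr>carrier = a_rcosets\<^bsub>M\<^esub> N, monoid.mult = undefined, monoid.one = undefined,
     ring.zero = N, ring.add = set_add M,
     smult = (\<lambda>r S. N <+>\<^bsub>M\<^esub> ((\<lambda>x. r \<odot>\<^bsub>M\<^esub> x) ` S))\<rparr>"

section \<open>Complete local rings and injective hulls\<close>

definition local_ring_with :: "('r, 'x) ring_scheme \<Rightarrow> 'r set \<Rightarrow> bool"
  where "local_ring_with R \<mm> \<longleftrightarrow>
    cring R \<and> maximalideal \<mm> R \<and> (\<forall>J. maximalideal J R \<longrightarrow> J = \<mm>)"

text \<open>Bijectivity of \<open>R \<rightarrow> lim R / I\<^sup>n\<close>: every coherent sequence of residues is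
  represented by exactly one element of \<open>R\<close>.\<close>

definition adically_complete :: "('r, 'x) ring_scheme \<Rightarrow> 'r set \<Rightarrow> bool"
  where "adically_complete R I \<longleftrightarrow>
    (\<forall>x :: nat \<Rightarrow> 'r.
       (\<forall>n. x n \<in> carrier R \<and> x (Suc n) \<ominus>\<^bsub>R\<^esub> x n \<in> I [^]\<^bsub>ideals_set R\<^esub> n) \<longrightarrow>
       (\<exists>!y. y \<in> carrier R \<and> (\<forall>n. y \<ominus>\<^bsub>R\<^esub> x n \<in> I [^]\<^bsub>ideals_set R\<^esub> n)))"

text \<open>The test modules \<open>M\<close> range over the modules carried by the element type of \<open>R\<close>. These
  include \<open>R\<close> itself, so by Baer's criterion the extension property then holds for test
  modules on every type.\<close>

definition injective_module :: "('r, 'x) ring_scheme \<Rightarrow> ('r, 'e, 'y) module_scheme \<Rightarrow> bool"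
  where "injective_module R E \<longleftrightarrow> module R E \<and>
    (\<forall>(M :: ('r, 'r) module) N f.
       module R M \<and> submodule N R M \<and> f \<in> mod_hom R (M\<lparr>carrier := N\<rparr>) E \<longrightarrow>
       (\<exists>g\<in>mod_hom R M E. \<forall>x\<in>N. g x = f x))"

definition injective_hull ::
  "('r, 'x) ring_scheme \<Rightarrow> ('r, 'a, 'y) module_scheme \<Rightarrow> ('r, 'e, 'z) module_scheme \<Rightarrow> bool"
  where "injective_hull R K E \<longleftrightarrow> injective_module R E \<and>
    (\<exists>\<iota>\<in>mod_hom R K E. inj_on \<iota> (carrier K) \<and>
       (\<forall>S. submodule S R E \<and> S \<noteq> {\<zero>\<^bsub>E\<^esub>} \<longrightarrow> S \<inter> \<iota> ` carrier K \<noteq> {\<zero>\<^bsub>E\<^esub>}))"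

section \<open>Matlis duality\<close>

text \<open>\<open>Hom\<^sub>R(M, E)\<close>; homomorphisms are made extensional so that they are determined by
  their values on the carrier of \<open>M\<close>.\<close>

definition dual ::
  "('r, 'x) ring_scheme \<Rightarrow> ('r, 'e, 'y) module_scheme \<Rightarrow> ('r, 'a, 'z) module_scheme \<Rightarrow>
   ('r, 'a \<Rightarrow> 'e) module"
  where "dual R E M =
    \<lparr>carrier = mod_hom R M E \<inter> extensional (carrier M), monoid.mult = undefined, monoid.one = undefined,
     ring.zero = (\<lambda>x\<in>carrier M. \<zero>\<^bsub>E\<^esub>),
     ring.add = (\<lambda>f g. \<lambda>x\<in>carrier M. f x \<oplus>\<^bsub>E\<^esub> g x),
     smult = (\<lambda>r f. \<lambda>x\<in>carrier M. r \<odot>\<^bsub>E\<^esub> f x)\<rparr>"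

definition eval_map ::
  "('r, 'x) ring_scheme \<Rightarrow> ('r, 'e, 'y) module_scheme \<Rightarrow> ('r, 'a, 'z) module_scheme \<Rightarrow>
   'a \<Rightarrow> ('a \<Rightarrow> 'e) \<Rightarrow> 'e"
  where "eval_map R E M x = (\<lambda>f\<in>carrier (dual R E M). f x)"

definition matlis_dualizable ::
  "('r, 'x) ring_scheme \<Rightarrow> ('r, 'e, 'y) module_scheme \<Rightarrow> ('r, 'a, 'z) module_scheme \<Rightarrow> bool"
  where "matlis_dualizable R E M \<longleftrightarrow>
    eval_map R E M \<in> mod_iso R M (dual R E (dual R E M))"

text \<open>\<open>(B/A)\<^sup>\<or>\<close> as a submodule of \<open>B\<^sup>\<or>\<close>: the image of the dual of the projection
  \<open>B \<rightarrow> B/A\<close>.\<close>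

definition quot_dual ::
  "('r, 'x) ring_scheme \<Rightarrow> ('r, 'e, 'y) module_scheme \<Rightarrow> 'a set \<Rightarrow> ('r, 'a, 'z) module_scheme \<Rightarrow>
   ('a \<Rightarrow> 'e) set"
  where "quot_dual R E A B =
    (\<lambda>f. \<lambda>x\<in>carrier B. f (A +>\<^bsub>B\<^esub> x)) ` carrier (dual R E (quot_module B A))"

section \<open>Pair operations\<close>

definition pair_class ::
  "('r, 'x) ring_scheme \<Rightarrow> ('a set \<times> ('r, 'a) module) set \<Rightarrow> bool"
  where "pair_class R P \<longleftrightarrow>
    (\<forall>(L, M)\<in>P. module R M \<and> submodule L R M) \<and>
    (\<forall>(L, M)\<in>P. \<forall>M' :: ('r, 'a) module. \<forall>\<phi>\<in>mod_iso R M M'.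
       module R M' \<longrightarrow> (\<phi> ` L, M') \<in> P)"

definition pair_operation ::
  "('r, 'x) ring_scheme \<Rightarrow> ('a set \<times> ('r, 'a) module) set \<Rightarrow>
   ('a set \<Rightarrow> ('r, 'a) module \<Rightarrow> 'a set) \<Rightarrow> bool"
  where "pair_operation R P p \<longleftrightarrow> pair_class R P \<and>
    (\<forall>(L, M)\<in>P. submodule (p L M) R M) \<and>
    (\<forall>(L, M)\<in>P. \<forall>M' :: ('r, 'a) module. \<forall>\<phi>\<in>mod_iso R M M'.
       module R M' \<longrightarrow> \<phi> ` p L M = p (\<phi> ` L) M')"

definition idempotent_op ::
  "('a set \<times> ('r, 'a) module) set \<Rightarrow> ('a set \<Rightarrow> ('r, 'a) module \<Rightarrow> 'a set) \<Rightarrow> bool"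
  where "idempotent_op P p \<longleftrightarrow>
    (\<forall>L M. (L, M) \<in> P \<and> (p L M, M) \<in> P \<longrightarrow> p (p L M) M = p L M)"

definition extensive ::
  "('a set \<times> ('r, 'a) module) set \<Rightarrow> ('a set \<Rightarrow> ('r, 'a) module \<Rightarrow> 'a set) \<Rightarrow> bool"
  where "extensive P p \<longleftrightarrow> (\<forall>(L, M)\<in>P. L \<subseteq> p L M)"

definition intensive ::
  "('a set \<times> ('r, 'a) module) set \<Rightarrow> ('a set \<Rightarrow> ('r, 'a) module \<Rightarrow> 'a set) \<Rightarrow> bool"
  where "intensive P p \<longleftrightarrow> (\<forall>(L, M)\<in>P. p L M \<subseteq> L)"

definition order_preserving ::
  "('a set \<times> ('r, 'a) module) set \<Rightarrow> ('a set \<Rightarrow> ('r, 'a) module \<Rightarrow> 'a set) \<Rightarrow> bool"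
  where "order_preserving P p \<longleftrightarrow>
    (\<forall>L N M. (L, M) \<in> P \<and> (N, M) \<in> P \<and> L \<subseteq> N \<longrightarrow> p L M \<subseteq> p N M)"

definition surjection_functorial ::
  "('r, 'x) ring_scheme \<Rightarrow> ('a set \<times> ('r, 'a) module) set \<Rightarrow>
   ('a set \<Rightarrow> ('r, 'a) module \<Rightarrow> 'a set) \<Rightarrow> bool"
  where "surjection_functorial R P p \<longleftrightarrow>
    (\<forall>L M M'. \<forall>\<pi>\<in>mod_hom R M M'.
       \<pi> ` carrier M = carrier M' \<and> (L, M) \<in> P \<and> (\<pi> ` L, M') \<in> P \<longrightarrow>
       \<pi> ` p L M \<subseteq> p (\<pi> ` L) M')"

definition functorial ::
  "('r, 'x) ring_scheme \<Rightarrow> ('a set \<times> ('r, 'a) module) set \<Rightarrow>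
   ('a set \<Rightarrow> ('r, 'a) module \<Rightarrow> 'a set) \<Rightarrow> bool"
  where "functorial R P p \<longleftrightarrow>
    (\<forall>L M M'. \<forall>g\<in>mod_hom R M M'.
       (L, M) \<in> P \<and> (g ` L, M') \<in> P \<longrightarrow> g ` p L M \<subseteq> p (g ` L) M')"

definition restrictable ::
  "('r, 'x) ring_scheme \<Rightarrow> ('a set \<times> ('r, 'a) module) set \<Rightarrow>
   ('a set \<Rightarrow> ('r, 'a) module \<Rightarrow> 'a set) \<Rightarrow> bool"
  where "restrictable R P p \<longleftrightarrow>
    (\<forall>L N M. submodule N R M \<and> (L \<inter> N, M\<lparr>carrier := N\<rparr>) \<in> P \<and> (L, M) \<in> P \<longrightarrow>
       p (L \<inter> N) (M\<lparr>carrier := N\<rparr>) \<subseteq> p L M)"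

definition closure_operation ::
  "('r, 'x) ring_scheme \<Rightarrow> ('a set \<times> ('r, 'a) module) set \<Rightarrow>
   ('a set \<Rightarrow> ('r, 'a) module \<Rightarrow> 'a set) \<Rightarrow> bool"
  where "closure_operation R P p \<longleftrightarrow>
    pair_operation R P p \<and> extensive P p \<and> order_preserving P p \<and> idempotent_op P p"

definition interior_operation ::
  "('r, 'x) ring_scheme \<Rightarrow> ('a set \<times> ('r, 'a) module) set \<Rightarrow>
   ('a set \<Rightarrow> ('r, 'a) module \<Rightarrow> 'a set) \<Rightarrow> bool"
  where "interior_operation R P p \<longleftrightarrow>
    pair_operation R P p \<and> intensive P p \<and> order_preserving P p \<and> idempotent_op P p"

text \<open>For a linear map \<open>g : M \<rightarrow> M'\<close>, the collection contains \<open>(g(g\<^sup>-\<^sup>1(L')), M')\<close> along with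
  \<open>(g\<^sup>-\<^sup>1(L'), M)\<close> and \<open>(L', M')\<close>, and \<open>(g\<^sup>-\<^sup>1(g(L)), M)\<close> along with \<open>(L, M)\<close> and
  \<open>(g(L), M')\<close>. This holds for the collection of all pairs of modules from a fixed
  isomorphism-closed class. It is used only in the last item of the theorem, which fails without it:
  over a field, let the pairs be the zero submodules of one-dimensional spaces and the lines in
  two-dimensional spaces, with \<open>p(0, M) = M\<close> for the former and \<open>p(L, M) = L\<close> for the latter. Then
  \<open>p\<close> is functorial and order-preserving, but its dual is not functorial, as any map from a plane
  onto a one-dimensional space that is injective on a given line shows.\<close>

definition closed_under_maps ::
  "('r, 'x) ring_scheme \<Rightarrow> ('a set \<times> ('r, 'a) module) set \<Rightarrow> bool"
  where "closed_under_maps R P \<longleftrightarrow>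
    (\<forall>L' M M'. \<forall>g\<in>mod_hom R M M'.
       ({x \<in> carrier M. g x \<in> L'}, M) \<in> P \<and> (L', M') \<in> P \<longrightarrow>
       (g ` {x \<in> carrier M. g x \<in> L'}, M') \<in> P) \<and>
    (\<forall>L M M'. \<forall>g\<in>mod_hom R M M'.
       (L, M) \<in> P \<and> (g ` L, M') \<in> P \<longrightarrow>
       ({x \<in> carrier M. g x \<in> g ` L}, M) \<in> P)"

section \<open>The dual pair operation\<close>

text \<open>A collection \<open>P\<close> lives on modules carried by one fixed type \<open>'a\<close>, whereas \<open>B\<^sup>\<or>\<close> is carried
  by a function type. Since collections are closed under isomorphism, membership in \<open>P\<close> and the
  values of \<open>p\<close> are transported along isomorphisms to modules on other types. The value below
  does not depend on the chosen isomorphism when \<open>p\<close> is a pair operation.\<close>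

definition transport_pairs ::
  "('r, 'x) ring_scheme \<Rightarrow> ('a set \<times> ('r, 'a) module) set \<Rightarrow> ('b set \<times> ('r, 'b) module) set"
  where "transport_pairs R P =
    {(L', M'). module R M' \<and> (\<exists>(L, M)\<in>P. \<exists>\<phi>\<in>mod_iso R M M'. L' = \<phi> ` L)}"

definition transport_op ::
  "('r, 'x) ring_scheme \<Rightarrow> ('a set \<times> ('r, 'a) module) set \<Rightarrow>
   ('a set \<Rightarrow> ('r, 'a) module \<Rightarrow> 'a set) \<Rightarrow> 'b set \<Rightarrow> ('r, 'b) module \<Rightarrow> 'b set"
  where "transport_op R P p L' M' =
    (THE K. \<exists>(L, M)\<in>P. \<exists>\<phi>\<in>mod_iso R M M'. L' = \<phi> ` L \<and> K = \<phi> ` p L M)"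

text \<open>\<open>P\<^sup>\<or>\<close>. The type \<open>'b\<close> carrying the dual pairs is free; for \<open>'b = 'a \<Rightarrow> 'e\<close>
  it contains the dual of every module on \<open>'a\<close>.\<close>

definition dual_pairs ::
  "('r, 'x) ring_scheme \<Rightarrow> ('r, 'e, 'y) module_scheme \<Rightarrow> ('a set \<times> ('r, 'a) module) set \<Rightarrow>
   ('b set \<times> ('r, 'b) module) set"
  where "dual_pairs R E P =
    {(A, B). module R B \<and> submodule A R B \<and>
       (quot_dual R E A B, dual R E B) \<in> transport_pairs R P}"

text \<open>\<open>(B\<^sup>\<or> / p((B/A)\<^sup>\<or>, B\<^sup>\<or>))\<^sup>\<or>\<close>, a submodule of \<open>B\<^sup>\<or>\<^sup>\<or>\<close>, pulled back to \<open>B\<close> along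
  the evaluation map.\<close>

definition dual_op ::
  "('r, 'x) ring_scheme \<Rightarrow> ('r, 'e, 'y) module_scheme \<Rightarrow> ('a set \<times> ('r, 'a) module) set \<Rightarrow>
   ('a set \<Rightarrow> ('r, 'a) module \<Rightarrow> 'a set) \<Rightarrow> 'b set \<Rightarrow> ('r, 'b) module \<Rightarrow> 'b set"
  where "dual_op R E P p A B =
    {b \<in> carrier B. eval_map R E B b \<in>
       quot_dual R E (transport_op R P p (quot_dual R E A B) (dual R E B)) (dual R E B)}"

end

theory Submission
  imports Defs
begin

text \<open>
  The idea is that \<open>B\<close> and \<open>B\<^sup>\<or>\<close> play symmetric roles. Call a bilinear map
  \<open>\<beta> : M \<times> N \<rightarrow> E\<close> a perfect pairing if every functional on \<open>M\<close> is \<open>\<beta>(-, y)\<close> for some \<open>y\<close> and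
  every functional on \<open>N\<close> is \<open>\<beta>(x, -)\<close> for some \<open>x\<close>. A module is Matlis-dualizable exactly when it
  takes part in such a pairing, and its partner is then a copy of its dual. Under the pairing
  \<open>(B/A)\<^sup>\<or>\<close> becomes the annihilator of \<open>A\<close>, written \<open>A\<^sup>\<bottom>\<close> below, and the definition
  of the dual operation becomes \<open>p\<^sup>\<smile>(A, B) = p(A\<^sup>\<bottom>, N)\<^sup>\<bottom>\<close> for any perfect partner
  \<open>N\<close> of \<open>B\<close> (\<open>dual_pairs_iff\<close>, \<open>dual_op_eq\<close>).

  Everything rests on \<open>A\<^sup>\<bottom>\<^sup>\<bottom> = A\<close> (\<open>perp_perp\<close>), which holds because \<open>E\<close> is a
  cogenerator: an element outside a submodule is detected by a functional that vanishes on the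
  submodule (\<open>separating_functional\<close>). Such a functional is first defined on the submodule
  together with the element, which it sends to a generator of the copy of \<open>k\<close> in \<open>E\<close>, and is then
  extended by Baer's criterion (\<open>baer_extension\<close>).

  The relation ``\<open>(Q, q)\<close> is dual to \<open>(P, p)\<close>'' is therefore symmetric and determines each side by
  the other (\<open>dual_operations_sym\<close>, \<open>dual_operations_subset\<close>). This gives the double dual, and it
  leaves only one direction to prove of each of the equivalences. Annihilators reverse inclusions,
  hence the exchange of extensive and intensive operations. A linear map \<open>g : B \<rightarrow> B'\<close> has an adjoint
  \<open>h : N' \<rightarrow> N\<close> between the partners, with \<open>g(A)\<^sup>\<bottom> = h\<^sup>-\<^sup>1(A\<^sup>\<bottom>)\<close> and
  \<open>(g\<^sup>-\<^sup>1(A'))\<^sup>\<bottom> = h(A'\<^sup>\<bottom>)\<close>. If \<open>g\<close> is surjective then \<open>h\<close> is injective, and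
  if \<open>g\<close> is an inclusion then \<open>h\<close> is surjective. So surjections on one side correspond to submodules
  on the other, which exchanges surjection-functoriality and restrictability.
\<close>

section \<open>Linear maps and submodules\<close>

lemma (in abelian_group) eq_if_minus_eq_zero:
  assumes "x \<in> carrier G" and "y \<in> carrier G" and "x \<ominus> y = \<zero>"
  shows "x = y"
proof -
  have "\<ominus> (\<ominus> y) = x"
    using assms minus_equality[of x "\<ominus> y"] by (simp add: a_minus_def)
  then show ?thesis using assms(2) by simp
qed

lemma mod_homI:
  assumes "\<And>x. x \<in> carrier M \<Longrightarrow> f x \<in> carrier N"
    and "\<And>x y. x \<in> carrier M \<Longrightarrow> y \<in> carrier M \<Longrightarrow> f (x \<oplus>\<^bsub>M\<^esub> y) = f x \<oplus>\<^bsub>N\<^esub> f y"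
    and "\<And>r x. r \<in> carrier R \<Longrightarrow> x \<in> carrier M \<Longrightarrow> f (r \<odot>\<^bsub>M\<^esub> x) = r \<odot>\<^bsub>N\<^esub> f x"
  shows "f \<in> mod_hom R M N"
  using assms by (auto simp: mod_hom_def)

lemma mod_homD:
  assumes "f \<in> mod_hom R M N"
  shows "x \<in> carrier M \<Longrightarrow> f x \<in> carrier N"
    and "x \<in> carrier M \<Longrightarrow> y \<in> carrier M \<Longrightarrow> f (x \<oplus>\<^bsub>M\<^esub> y) = f x \<oplus>\<^bsub>N\<^esub> f y"
    and "r \<in> carrier R \<Longrightarrow> x \<in> carrier M \<Longrightarrow> f (r \<odot>\<^bsub>M\<^esub> x) = r \<odot>\<^bsub>N\<^esub> f x"
  using assms by (auto simp: mod_hom_def)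

lemma mod_hom_comp:
  assumes "f \<in> mod_hom R M N" and "g \<in> mod_hom R N K"
  shows "(\<lambda>x. g (f x)) \<in> mod_hom R M K"
  by (rule mod_homI) (simp_all add: mod_homD[OF assms(1)] mod_homD[OF assms(2)])

lemma mod_hom_zero:
  assumes "module R M" and "module R N" and "f \<in> mod_hom R M N"
  shows "f \<zero>\<^bsub>M\<^esub> = \<zero>\<^bsub>N\<^esub>"
proof -
  interpret M: module R M by fact
  interpret N: module R N by fact
  have "f (\<zero>\<^bsub>R\<^esub> \<odot>\<^bsub>M\<^esub> \<zero>\<^bsub>M\<^esub>) = \<zero>\<^bsub>R\<^esub> \<odot>\<^bsub>N\<^esub> f \<zero>\<^bsub>M\<^esub>"
    using mod_homD(3)[OF assms(3)] by blast
  then show ?thesis using mod_homD(1)[OF assms(3)] by simp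
qed

lemma mod_hom_minus:
  assumes "module R M" and "module R N" and "f \<in> mod_hom R M N"
    and "x \<in> carrier M" and "y \<in> carrier M"
  shows "f (x \<ominus>\<^bsub>M\<^esub> y) = f x \<ominus>\<^bsub>N\<^esub> f y"
proof -
  interpret M: module R M by fact
  interpret N: module R N by fact
  have eq: "x \<ominus>\<^bsub>M\<^esub> y = x \<oplus>\<^bsub>M\<^esub> (\<ominus>\<^bsub>R\<^esub> \<one>\<^bsub>R\<^esub>) \<odot>\<^bsub>M\<^esub> y"
    using assms(5) by (simp add: M.smult_l_minus a_minus_def)
  have "f (x \<ominus>\<^bsub>M\<^esub> y) = f x \<oplus>\<^bsub>N\<^esub> (\<ominus>\<^bsub>R\<^esub> \<one>\<^bsub>R\<^esub>) \<odot>\<^bsub>N\<^esub> f y"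
    using assms(4,5) by (simp add: eq mod_homD[OF assms(3)])
  also have "\<dots> = f x \<ominus>\<^bsub>N\<^esub> f y"
    using assms(4,5) by (simp add: N.smult_l_minus a_minus_def mod_homD[OF assms(3)])
  finally show ?thesis .
qed

lemma submodule_iff:
  assumes "module R M"
  shows "submodule H R M \<longleftrightarrow> H \<subseteq> carrier M \<and> \<zero>\<^bsub>M\<^esub> \<in> H \<and>
    (\<forall>x\<in>H. \<forall>y\<in>H. x \<oplus>\<^bsub>M\<^esub> y \<in> H) \<and> (\<forall>r\<in>carrier R. \<forall>x\<in>H. r \<odot>\<^bsub>M\<^esub> x \<in> H)"
proof -
  interpret module R M by fact
  show ?thesis
  proof (intro iffI conjI ballI)
    assume H: "submodule H R M"
    note E = submoduleE[OF H]
    show "H \<subseteq> carrier M" by (rule E(1))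
    obtain x where "x \<in> H" using E(2) by auto
    then show "\<zero>\<^bsub>M\<^esub> \<in> H" using E(1) E(4)[of "\<zero>\<^bsub>R\<^esub>" x] by auto
    show "x \<oplus>\<^bsub>M\<^esub> y \<in> H" if "x \<in> H" "y \<in> H" for x y using that by (rule E(5))
    show "r \<odot>\<^bsub>M\<^esub> x \<in> H" if "r \<in> carrier R" "x \<in> H" for r x using that by (rule E(4))
  next
  assume *: "H \<subseteq> carrier M \<and> \<zero>\<^bsub>M\<^esub> \<in> H \<and>
    (\<forall>x\<in>H. \<forall>y\<in>H. x \<oplus>\<^bsub>M\<^esub> y \<in> H) \<and> (\<forall>r\<in>carrier R. \<forall>x\<in>H. r \<odot>\<^bsub>M\<^esub> x \<in> H)"
  show "submodule H R M"
  proof (rule submoduleI)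
    fix a assume a: "a \<in> H"
    then have "(\<ominus>\<^bsub>R\<^esub> \<one>\<^bsub>R\<^esub>) \<odot>\<^bsub>M\<^esub> a \<in> H" using * by simp
    moreover have "a \<in> carrier M" using a * by blast
    ultimately show "\<ominus>\<^bsub>M\<^esub> a \<in> H" by (simp add: smult_l_minus)
  qed (use * in auto)
  qed
qed

lemma submodule_image:
  assumes "module R M" and "module R N" and "f \<in> mod_hom R M N" and "submodule L R M"
  shows "submodule (f ` L) R N"
proof -
  note L = assms(4)[unfolded submodule_iff[OF assms(1)]]
  show ?thesis
    unfolding submodule_iff[OF assms(2)]
  proof (intro conjI ballI)
    show "f ` L \<subseteq> carrier N" using L mod_homD(1)[OF assms(3)] by auto
    show "\<zero>\<^bsub>N\<^esub> \<in> f ` L" using L mod_hom_zero[OF assms(1-3)] by (metis imageI)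
  next
    fix x y assume "x \<in> f ` L" "y \<in> f ` L"
    then obtain a b where "a \<in> L" "b \<in> L" "x = f a" "y = f b" by auto
    then have "x \<oplus>\<^bsub>N\<^esub> y = f (a \<oplus>\<^bsub>M\<^esub> b)" "a \<oplus>\<^bsub>M\<^esub> b \<in> L"
      using L mod_homD(2)[OF assms(3)] by (auto simp: subset_iff)
    then show "x \<oplus>\<^bsub>N\<^esub> y \<in> f ` L" by simp
  next
    fix r x assume r: "r \<in> carrier R" and "x \<in> f ` L"
    then obtain a where "a \<in> L" "x = f a" by auto
    then have "r \<odot>\<^bsub>N\<^esub> x = f (r \<odot>\<^bsub>M\<^esub> a)" "r \<odot>\<^bsub>M\<^esub> a \<in> L"
      using L r mod_homD(3)[OF assms(3)] by (auto simp: subset_iff)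
    then show "r \<odot>\<^bsub>N\<^esub> x \<in> f ` L" by simp
  qed
qed

lemma mod_isoD:
  assumes "f \<in> mod_iso R M N"
  shows "f \<in> mod_hom R M N" and "bij_betw f (carrier M) (carrier N)"
    and "inj_on f (carrier M)" and "f ` carrier M = carrier N"
  using assms by (auto simp: mod_iso_def bij_betw_def)

lemma mod_iso_comp:
  assumes "f \<in> mod_iso R M N" and "g \<in> mod_iso R N K"
  shows "(\<lambda>x. g (f x)) \<in> mod_iso R M K"
  using mod_hom_comp[of f R M N g K] bij_betw_trans[of f "carrier M" "carrier N" g "carrier K"] assms
  by (simp add: mod_iso_def comp_def)

lemma mod_iso_inv:
  assumes "module R M" and f: "f \<in> mod_iso R M N"
  shows "inv_into (carrier M) f \<in> mod_iso R N M"
proof -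
  interpret module R M by fact
  let ?g = "inv_into (carrier M) f"
  have bij: "bij_betw ?g (carrier N) (carrier M)"
    using mod_isoD(2)[OF f] by (rule bij_betw_inv_into)
  have g: "?g y \<in> carrier M" "f (?g y) = y" if "y \<in> carrier N" for y
    using that mod_isoD(4)[OF f] by (auto simp: inv_into_into f_inv_into_f)
  have gf: "?g (f x) = x" if "x \<in> carrier M" for x
    using that mod_isoD(3)[OF f] by simp
  have "?g \<in> mod_hom R N M"
  proof (rule mod_homI)
    fix x y assume xy: "x \<in> carrier N" "y \<in> carrier N"
    have "f (?g x \<oplus>\<^bsub>M\<^esub> ?g y) = x \<oplus>\<^bsub>N\<^esub> y"
      using xy g mod_homD(2)[OF mod_isoD(1)[OF f]] by simp
    then show "?g (x \<oplus>\<^bsub>N\<^esub> y) = ?g x \<oplus>\<^bsub>M\<^esub> ?g y"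
      using gf[of "?g x \<oplus>\<^bsub>M\<^esub> ?g y"] g xy by simp
  next
    fix r x assume rx: "r \<in> carrier R" "x \<in> carrier N"
    have "f (r \<odot>\<^bsub>M\<^esub> ?g x) = r \<odot>\<^bsub>N\<^esub> x"
      using rx g mod_homD(3)[OF mod_isoD(1)[OF f]] by simp
    then show "?g (r \<odot>\<^bsub>N\<^esub> x) = r \<odot>\<^bsub>M\<^esub> ?g x"
      using gf[of "r \<odot>\<^bsub>M\<^esub> ?g x"] g rx by simp
  qed (use g in auto)
  then show ?thesis using bij by (simp add: mod_iso_def)
qed

section \<open>Extension of partial homomorphisms into an injective module\<close>

text \<open>A homomorphism from a submodule of \<open>M\<close> to \<open>N\<close>, encoded by its graph, so that extension of
  homomorphisms is inclusion of sets and Zorn's lemma for sets applies. The last condition suffices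
  for single-valuedness because the graph is closed under linear combinations.\<close>

definition partial_hom ::
  "('r, 'x) ring_scheme \<Rightarrow> ('r, 'a, 'y) module_scheme \<Rightarrow> ('r, 'b, 'z) module_scheme \<Rightarrow> ('a \<times> 'b) set \<Rightarrow> bool"
  where "partial_hom R M N G \<longleftrightarrow>
    G \<subseteq> carrier M \<times> carrier N \<and> (\<zero>\<^bsub>M\<^esub>, \<zero>\<^bsub>N\<^esub>) \<in> G \<and>
    (\<forall>(x, u)\<in>G. \<forall>(y, v)\<in>G. (x \<oplus>\<^bsub>M\<^esub> y, u \<oplus>\<^bsub>N\<^esub> v) \<in> G) \<and>
    (\<forall>r\<in>carrier R. \<forall>(x, u)\<in>G. (r \<odot>\<^bsub>M\<^esub> x, r \<odot>\<^bsub>N\<^esub> u) \<in> G) \<and>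
    (\<forall>u. (\<zero>\<^bsub>M\<^esub>, u) \<in> G \<longrightarrow> u = \<zero>\<^bsub>N\<^esub>)"

lemma partial_homD:
  assumes "partial_hom R M N G"
  shows "(x, u) \<in> G \<Longrightarrow> x \<in> carrier M" and "(x, u) \<in> G \<Longrightarrow> u \<in> carrier N"
    and "(\<zero>\<^bsub>M\<^esub>, \<zero>\<^bsub>N\<^esub>) \<in> G"
    and "(x, u) \<in> G \<Longrightarrow> (y, v) \<in> G \<Longrightarrow> (x \<oplus>\<^bsub>M\<^esub> y, u \<oplus>\<^bsub>N\<^esub> v) \<in> G"
    and "r \<in> carrier R \<Longrightarrow> (x, u) \<in> G \<Longrightarrow> (r \<odot>\<^bsub>M\<^esub> x, r \<odot>\<^bsub>N\<^esub> u) \<in> G"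
    and "(\<zero>\<^bsub>M\<^esub>, u) \<in> G \<Longrightarrow> u = \<zero>\<^bsub>N\<^esub>"
  using assms unfolding partial_hom_def by blast+

lemma partial_hom_neg:
  assumes "module R M" and "module R N" and "partial_hom R M N G" and "(x, u) \<in> G"
  shows "(\<ominus>\<^bsub>M\<^esub> x, \<ominus>\<^bsub>N\<^esub> u) \<in> G"
proof -
  interpret M: module R M by fact
  interpret N: module R N by fact
  note G = partial_homD[OF assms(3)]
  have "((\<ominus>\<^bsub>R\<^esub> \<one>\<^bsub>R\<^esub>) \<odot>\<^bsub>M\<^esub> x, (\<ominus>\<^bsub>R\<^esub> \<one>\<^bsub>R\<^esub>) \<odot>\<^bsub>N\<^esub> u) \<in> G" using G(5) assms(4) by simp
  then show ?thesis using G(1,2)[OF assms(4)] by (simp add: M.smult_l_minus N.smult_l_minus)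
qed

lemma partial_hom_unique:
  assumes "module R M" and "module R N" and "partial_hom R M N G"
    and u: "(x, u) \<in> G" and v: "(x, v) \<in> G"
  shows "u = v"
proof -
  interpret M: module R M by fact
  interpret N: module R N by fact
  note G = partial_homD[OF assms(3)]
  have "(x \<oplus>\<^bsub>M\<^esub> \<ominus>\<^bsub>M\<^esub> x, u \<oplus>\<^bsub>N\<^esub> \<ominus>\<^bsub>N\<^esub> v) \<in> G"
    using G(4)[OF u] partial_hom_neg[OF assms(1-3) v] by blast
  then have "u \<oplus>\<^bsub>N\<^esub> \<ominus>\<^bsub>N\<^esub> v = \<zero>\<^bsub>N\<^esub>"
    using G(6) G(1)[OF u] by (simp add: M.M.r_neg)
  then show ?thesis using G(2)[OF u] G(2)[OF v]
    N.M.eq_if_minus_eq_zero[of u v] by (simp add: a_minus_def)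
qed

text \<open>The new graph is the sum of \<open>G\<close> and the line through \<open>(x, e)\<close>. It is single-valued
  because \<open>compat\<close> makes \<open>e\<close> agree with \<open>G\<close> on every multiple of \<open>x\<close> that \<open>G\<close> already reaches.\<close>

lemma partial_hom_extend:
  assumes "module R M" and "module R N" and "partial_hom R M N G"
    and x: "x \<in> carrier M" and e: "e \<in> carrier N"
    and compat: "\<And>r u. r \<in> carrier R \<Longrightarrow> (r \<odot>\<^bsub>M\<^esub> x, u) \<in> G \<Longrightarrow> u = r \<odot>\<^bsub>N\<^esub> e"
  shows "\<exists>G'. partial_hom R M N G' \<and> G \<subseteq> G' \<and> (x, e) \<in> G'"
proof -
  interpret M: module R M by fact
  interpret N: module R N by fact
  note G = partial_homD[OF assms(3)]
  let ?G' = "{(y \<oplus>\<^bsub>M\<^esub> r \<odot>\<^bsub>M\<^esub> x, u \<oplus>\<^bsub>N\<^esub> r \<odot>\<^bsub>N\<^esub> e) | y u r. (y, u) \<in> G \<and> r \<in> carrier R}"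
  have mem: "(y \<oplus>\<^bsub>M\<^esub> r \<odot>\<^bsub>M\<^esub> x, u \<oplus>\<^bsub>N\<^esub> r \<odot>\<^bsub>N\<^esub> e) \<in> ?G'" if "(y, u) \<in> G" "r \<in> carrier R" for y u r
    using that by blast
  have sub: "G \<subseteq> ?G'"
  proof
    fix z assume z: "z \<in> G"
    obtain y u where yu: "z = (y, u)" by (cases z)
    have "(y \<oplus>\<^bsub>M\<^esub> \<zero>\<^bsub>R\<^esub> \<odot>\<^bsub>M\<^esub> x, u \<oplus>\<^bsub>N\<^esub> \<zero>\<^bsub>R\<^esub> \<odot>\<^bsub>N\<^esub> e) = z"
      using z yu G(1,2) x e by simp
    then show "z \<in> ?G'" using mem[of y u "\<zero>\<^bsub>R\<^esub>"] z yu by simp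
  qed
  have "partial_hom R M N ?G'"
    unfolding partial_hom_def
  proof (intro conjI)
    show "?G' \<subseteq> carrier M \<times> carrier N" using G(1,2) x e by auto
    show "(\<zero>\<^bsub>M\<^esub>, \<zero>\<^bsub>N\<^esub>) \<in> ?G'" using sub G(3) by blast
    show "\<forall>(z, w)\<in>?G'. \<forall>(z', w')\<in>?G'. (z \<oplus>\<^bsub>M\<^esub> z', w \<oplus>\<^bsub>N\<^esub> w') \<in> ?G'"
    proof clarify
      fix y u r y' u' r'
      assume a: "(y, u) \<in> G" "r \<in> carrier R" "(y', u') \<in> G" "r' \<in> carrier R"
      have "(y \<oplus>\<^bsub>M\<^esub> r \<odot>\<^bsub>M\<^esub> x) \<oplus>\<^bsub>M\<^esub> (y' \<oplus>\<^bsub>M\<^esub> r' \<odot>\<^bsub>M\<^esub> x) = (y \<oplus>\<^bsub>M\<^esub> y') \<oplus>\<^bsub>M\<^esub> (r \<oplus>\<^bsub>R\<^esub> r') \<odot>\<^bsub>M\<^esub> x"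
        using a G(1) x by (simp add: M.smult_l_distr M.M.a_ac)
      moreover have "(u \<oplus>\<^bsub>N\<^esub> r \<odot>\<^bsub>N\<^esub> e) \<oplus>\<^bsub>N\<^esub> (u' \<oplus>\<^bsub>N\<^esub> r' \<odot>\<^bsub>N\<^esub> e) = (u \<oplus>\<^bsub>N\<^esub> u') \<oplus>\<^bsub>N\<^esub> (r \<oplus>\<^bsub>R\<^esub> r') \<odot>\<^bsub>N\<^esub> e"
        using a G(2) e by (simp add: N.smult_l_distr N.M.a_ac)
      ultimately show "\<exists>ya ua ra. ((y \<oplus>\<^bsub>M\<^esub> r \<odot>\<^bsub>M\<^esub> x) \<oplus>\<^bsub>M\<^esub> (y' \<oplus>\<^bsub>M\<^esub> r' \<odot>\<^bsub>M\<^esub> x),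
            (u \<oplus>\<^bsub>N\<^esub> r \<odot>\<^bsub>N\<^esub> e) \<oplus>\<^bsub>N\<^esub> (u' \<oplus>\<^bsub>N\<^esub> r' \<odot>\<^bsub>N\<^esub> e)) =
           (ya \<oplus>\<^bsub>M\<^esub> ra \<odot>\<^bsub>M\<^esub> x, ua \<oplus>\<^bsub>N\<^esub> ra \<odot>\<^bsub>N\<^esub> e) \<and> (ya, ua) \<in> G \<and> ra \<in> carrier R"
        using G(4) a by (metis M.R.add.m_closed)
    qed
    show "\<forall>s\<in>carrier R. \<forall>(z, w)\<in>?G'. (s \<odot>\<^bsub>M\<^esub> z, s \<odot>\<^bsub>N\<^esub> w) \<in> ?G'"
    proof clarify
      fix s y u r assume a: "s \<in> carrier R" "(y, u) \<in> G" "r \<in> carrier R"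
      have "s \<odot>\<^bsub>M\<^esub> (y \<oplus>\<^bsub>M\<^esub> r \<odot>\<^bsub>M\<^esub> x) = s \<odot>\<^bsub>M\<^esub> y \<oplus>\<^bsub>M\<^esub> (s \<otimes>\<^bsub>R\<^esub> r) \<odot>\<^bsub>M\<^esub> x"
        using a G(1) x by (simp add: M.smult_r_distr M.smult_assoc1)
      moreover have "s \<odot>\<^bsub>N\<^esub> (u \<oplus>\<^bsub>N\<^esub> r \<odot>\<^bsub>N\<^esub> e) = s \<odot>\<^bsub>N\<^esub> u \<oplus>\<^bsub>N\<^esub> (s \<otimes>\<^bsub>R\<^esub> r) \<odot>\<^bsub>N\<^esub> e"
        using a G(2) e by (simp add: N.smult_r_distr N.smult_assoc1)
      ultimately show "\<exists>ya ua ra. (s \<odot>\<^bsub>M\<^esub> (y \<oplus>\<^bsub>M\<^esub> r \<odot>\<^bsub>M\<^esub> x), s \<odot>\<^bsub>N\<^esub> (u \<oplus>\<^bsub>N\<^esub> r \<odot>\<^bsub>N\<^esub> e)) =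
           (ya \<oplus>\<^bsub>M\<^esub> ra \<odot>\<^bsub>M\<^esub> x, ua \<oplus>\<^bsub>N\<^esub> ra \<odot>\<^bsub>N\<^esub> e) \<and> (ya, ua) \<in> G \<and> ra \<in> carrier R"
        using G(5) a by (metis M.R.m_closed)
    qed
    show "\<forall>w. (\<zero>\<^bsub>M\<^esub>, w) \<in> ?G' \<longrightarrow> w = \<zero>\<^bsub>N\<^esub>"
    proof clarify
      fix y u r assume a: "\<zero>\<^bsub>M\<^esub> = y \<oplus>\<^bsub>M\<^esub> r \<odot>\<^bsub>M\<^esub> x" "(y, u) \<in> G" "r \<in> carrier R"
      note c = G(1)[OF a(2)] G(2)[OF a(2)]
      have "\<ominus>\<^bsub>M\<^esub> y = r \<odot>\<^bsub>M\<^esub> x" using a c x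
        by (metis M.M.minus_equality M.M.a_comm M.smult_closed)
      then have "\<ominus>\<^bsub>N\<^esub> u = r \<odot>\<^bsub>N\<^esub> e"
        using compat[OF a(3)] partial_hom_neg[OF assms(1-3) a(2)] by simp
      then show "u \<oplus>\<^bsub>N\<^esub> r \<odot>\<^bsub>N\<^esub> e = \<zero>\<^bsub>N\<^esub>" using c by (metis N.M.r_neg)
    qed
  qed
  moreover have "(x, e) \<in> ?G'"
    using mem[OF G(3) M.R.one_closed] x e by simp
  ultimately show ?thesis using sub by blast
qed

lemma self_module_simps [simp]:
  "carrier (self_module R) = carrier R" "\<zero>\<^bsub>self_module R\<^esub> = \<zero>\<^bsub>R\<^esub>"
  "x \<oplus>\<^bsub>self_module R\<^esub> y = x \<oplus>\<^bsub>R\<^esub> y" "r \<odot>\<^bsub>self_module R\<^esub> x = r \<otimes>\<^bsub>R\<^esub> x"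
  by (simp_all add: self_module_def)

lemma (in cring) self_module_is_module: "module R (self_module R)"
proof (rule moduleI)
  show "abelian_group (self_module R)"
  proof (rule abelian_groupI)
    show "\<exists>y\<in>carrier (self_module R). y \<oplus>\<^bsub>self_module R\<^esub> x = \<zero>\<^bsub>self_module R\<^esub>"
      if "x \<in> carrier (self_module R)" for x
      using that by (intro bexI[of _ "\<ominus> x"]) (simp_all add: l_neg)
  qed (simp_all add: a_ac)
qed (simp_all add: is_cring l_distr r_distr m_assoc)

lemma partial_hom_Union:
  assumes "\<C> \<noteq> {}" and ph: "\<And>G. G \<in> \<C> \<Longrightarrow> partial_hom R M N G"
    and chain: "\<And>G H. G \<in> \<C> \<Longrightarrow> H \<in> \<C> \<Longrightarrow> G \<subseteq> H \<or> H \<subseteq> G"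
  shows "partial_hom R M N (\<Union>\<C>)"
  unfolding partial_hom_def
proof (intro conjI)
  show "\<Union>\<C> \<subseteq> carrier M \<times> carrier N"
    using ph by (intro Union_least) (simp add: partial_hom_def)
  show "(\<zero>\<^bsub>M\<^esub>, \<zero>\<^bsub>N\<^esub>) \<in> \<Union>\<C>" using assms(1) partial_homD(3)[OF ph] by blast
  show "\<forall>(x, u)\<in>\<Union>\<C>. \<forall>(y, v)\<in>\<Union>\<C>. (x \<oplus>\<^bsub>M\<^esub> y, u \<oplus>\<^bsub>N\<^esub> v) \<in> \<Union>\<C>"
  proof clarify
    fix x u y v G H assume a: "(x, u) \<in> G" "G \<in> \<C>" "(y, v) \<in> H" "H \<in> \<C>"
    then consider "(y, v) \<in> G" | "(x, u) \<in> H" using chain[of G H] by blast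
    then show "(x \<oplus>\<^bsub>M\<^esub> y, u \<oplus>\<^bsub>N\<^esub> v) \<in> \<Union>\<C>"
      using a partial_homD(4)[OF ph] by cases blast+
  qed
  show "\<forall>r\<in>carrier R. \<forall>(x, u)\<in>\<Union>\<C>. (r \<odot>\<^bsub>M\<^esub> x, r \<odot>\<^bsub>N\<^esub> u) \<in> \<Union>\<C>"
    using partial_homD(5)[OF ph] by blast
  show "\<forall>u. (\<zero>\<^bsub>M\<^esub>, u) \<in> \<Union>\<C> \<longrightarrow> u = \<zero>\<^bsub>N\<^esub>" using partial_homD(6)[OF ph] by blast
qed

text \<open>The scalars \<open>r\<close> for which \<open>r x\<close> lies in the domain of \<open>H\<close> form an ideal, and sending \<open>r\<close> to
  the value of \<open>H\<close> at \<open>r x\<close> is linear on it. By injectivity this map extends to all of \<open>R\<close>, where it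
  is multiplication by its value at \<open>1\<close>; that value is the element \<open>e\<close> sought.\<close>

lemma injective_ideal_hom:
  assumes E: "injective_module R E" and M: "module R M" and H: "partial_hom R M E H"
    and x: "x \<in> carrier M"
  shows "\<exists>e\<in>carrier E. \<forall>r\<in>carrier R. \<forall>u. (r \<odot>\<^bsub>M\<^esub> x, u) \<in> H \<longrightarrow> u = r \<odot>\<^bsub>E\<^esub> e"
proof -
  have Em: "module R E" using E unfolding injective_module_def by (rule conjunct1)
  interpret M: module R M by fact
  interpret E: module R E by fact
  note HD = partial_homD[OF H] and uniq = partial_hom_unique[OF M Em H]
  define I where "I = {r \<in> carrier R. \<exists>u. (r \<odot>\<^bsub>M\<^esub> x, u) \<in> H}"
  define h where "h r = (SOME u. (r \<odot>\<^bsub>M\<^esub> x, u) \<in> H)" for r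
  have h: "h r = u" if "(r \<odot>\<^bsub>M\<^esub> x, u) \<in> H" for r u
    unfolding h_def using that uniq by blast
  have I: "submodule I R (self_module R)"
    unfolding submodule_iff[OF M.self_module_is_module]
  proof (intro conjI ballI)
    show "\<zero>\<^bsub>self_module R\<^esub> \<in> I" using HD(3) x by (auto simp: I_def)
  next
    fix r s assume rs: "r \<in> I" "s \<in> I"
    then obtain u v where "(r \<odot>\<^bsub>M\<^esub> x, u) \<in> H" "(s \<odot>\<^bsub>M\<^esub> x, v) \<in> H" by (auto simp: I_def)
    then have "((r \<oplus>\<^bsub>R\<^esub> s) \<odot>\<^bsub>M\<^esub> x, u \<oplus>\<^bsub>E\<^esub> v) \<in> H"
      using HD(4) rs x by (auto simp: I_def M.smult_l_distr)
    then show "r \<oplus>\<^bsub>self_module R\<^esub> s \<in> I" using rs by (auto simp: I_def)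
  next
    fix r s assume rs: "r \<in> carrier R" "s \<in> I"
    then obtain v where "(s \<odot>\<^bsub>M\<^esub> x, v) \<in> H" by (auto simp: I_def)
    then have "((r \<otimes>\<^bsub>R\<^esub> s) \<odot>\<^bsub>M\<^esub> x, r \<odot>\<^bsub>E\<^esub> v) \<in> H"
      using HD(5) rs x by (auto simp: I_def M.smult_assoc1)
    then show "r \<odot>\<^bsub>self_module R\<^esub> s \<in> I" using rs by (auto simp: I_def)
  qed (auto simp: I_def)
  have "h \<in> mod_hom R (self_module R\<lparr>carrier := I\<rparr>) E"
  proof (rule mod_homI)
    fix r assume "r \<in> carrier (self_module R\<lparr>carrier := I\<rparr>)"
    then show "h r \<in> carrier E" using h HD(2) by (auto simp: I_def)
  next
    fix r s assume "r \<in> carrier (self_module R\<lparr>carrier := I\<rparr>)" "s \<in> carrier (self_module R\<lparr>carrier := I\<rparr>)"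
    then obtain u v where rs: "r \<in> carrier R" "s \<in> carrier R"
      and uv: "(r \<odot>\<^bsub>M\<^esub> x, u) \<in> H" "(s \<odot>\<^bsub>M\<^esub> x, v) \<in> H" by (auto simp: I_def)
    then have "((r \<oplus>\<^bsub>R\<^esub> s) \<odot>\<^bsub>M\<^esub> x, u \<oplus>\<^bsub>E\<^esub> v) \<in> H"
      using HD(4) x by (auto simp: M.smult_l_distr)
    then show "h (r \<oplus>\<^bsub>self_module R\<lparr>carrier := I\<rparr>\<^esub> s) = h r \<oplus>\<^bsub>E\<^esub> h s"
      using h uv by simp
  next
    fix r s assume r: "r \<in> carrier R" and "s \<in> carrier (self_module R\<lparr>carrier := I\<rparr>)"
    then obtain v where s: "s \<in> carrier R" and v: "(s \<odot>\<^bsub>M\<^esub> x, v) \<in> H" by (auto simp: I_def)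
    then have "((r \<otimes>\<^bsub>R\<^esub> s) \<odot>\<^bsub>M\<^esub> x, r \<odot>\<^bsub>E\<^esub> v) \<in> H"
      using HD(5) r x by (auto simp: M.smult_assoc1)
    then show "h (r \<odot>\<^bsub>self_module R\<lparr>carrier := I\<rparr>\<^esub> s) = r \<odot>\<^bsub>E\<^esub> h s"
      using h v by simp
  qed
  then obtain g where g: "g \<in> mod_hom R (self_module R) E" and gh: "\<forall>r\<in>I. g r = h r"
    using E I M.self_module_is_module unfolding injective_module_def by blast
  have "u = r \<odot>\<^bsub>E\<^esub> g \<one>\<^bsub>R\<^esub>" if "r \<in> carrier R" "(r \<odot>\<^bsub>M\<^esub> x, u) \<in> H" for r u
  proof -
    have "u = g r" using gh h that by (auto simp: I_def)
    also have "\<dots> = r \<odot>\<^bsub>E\<^esub> g \<one>\<^bsub>R\<^esub>"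
      using mod_homD(3)[OF g that(1), of "\<one>\<^bsub>R\<^esub>"] that(1) by simp
    finally show ?thesis .
  qed
  then show ?thesis using mod_homD(1)[OF g, of "\<one>\<^bsub>R\<^esub>"] by auto
qed

text \<open>Baer's criterion, for modules on an arbitrary type: by Zorn's lemma there is a maximal partial
  homomorphism containing \<open>G\<close>, and it is defined everywhere, since at any \<open>x\<close> the preceding lemma
  supplies a value compatible with it.\<close>

lemma baer_extension:
  assumes E: "injective_module R E" and M: "module R M" and G: "partial_hom R M E G"
  shows "\<exists>f\<in>mod_hom R M E. \<forall>(x, u)\<in>G. f x = u"
proof -
  have Em: "module R E" using E unfolding injective_module_def by (rule conjunct1)
  define \<A> where "\<A> = {H. partial_hom R M E H \<and> G \<subseteq> H}"
  have "\<exists>H\<in>\<A>. \<forall>Y\<in>\<A>. H \<subseteq> Y \<longrightarrow> Y = H"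
  proof (rule subset_Zorn_nonempty)
    have "G \<in> \<A>" using G by (simp add: \<A>_def)
    then show "\<A> \<noteq> {}" by (metis empty_iff)
    fix \<C> assume C: "\<C> \<noteq> {}" "subset.chain \<A> \<C>"
    then have CA: "\<C> \<subseteq> \<A>" and chain: "\<forall>H\<in>\<C>. \<forall>Y\<in>\<C>. H \<subseteq> Y \<or> Y \<subseteq> H"
      by (simp_all add: subset_chain_def)
    have mem: "partial_hom R M E H" "G \<subseteq> H" if "H \<in> \<C>" for H
      using subsetD[OF CA that] by (simp_all add: \<A>_def)
    have "partial_hom R M E (\<Union>\<C>)"
      by (rule partial_hom_Union[OF C(1) mem(1)]) (use chain in blast)+
    moreover obtain H where "H \<in> \<C>" using C(1) by (metis all_not_in_conv)
    then have "G \<subseteq> \<Union>\<C>" using mem(2) by (metis Sup_upper2)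
    ultimately show "\<Union>\<C> \<in> \<A>" by (simp add: \<A>_def)
  qed
  then obtain H where "H \<in> \<A>" and max: "\<forall>Y\<in>\<A>. H \<subseteq> Y \<longrightarrow> Y = H"
    by (elim bexE)
  then have H: "partial_hom R M E H" and GH: "G \<subseteq> H" by (simp_all add: \<A>_def)
  note HD = partial_homD[OF H] and uniq = partial_hom_unique[OF M Em H]
  have ex: "\<exists>u. (x, u) \<in> H" if x: "x \<in> carrier M" for x
  proof -
    obtain e where e: "e \<in> carrier E"
      "\<forall>r\<in>carrier R. \<forall>u. (r \<odot>\<^bsub>M\<^esub> x, u) \<in> H \<longrightarrow> u = r \<odot>\<^bsub>E\<^esub> e"
      using injective_ideal_hom[OF E M H x] by (elim bexE)
    have "\<exists>H'. partial_hom R M E H' \<and> H \<subseteq> H' \<and> (x, e) \<in> H'"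
      by (rule partial_hom_extend[OF M Em H x e(1)]) (use e(2) in simp)
    then obtain H' where H': "partial_hom R M E H'" "H \<subseteq> H'" "(x, e) \<in> H'"
      by (elim exE conjE)
    then have "H' \<in> \<A>" using GH by (simp add: \<A>_def)
    then have "H' = H" using max H'(2) by simp
    then show ?thesis using H'(3) by auto
  qed
  define f where "f x = (SOME u. (x, u) \<in> H)" for x
  have f': "(x, f x) \<in> H" if "x \<in> carrier M" for x
    unfolding f_def using ex[OF that] by (rule someI_ex)
  have f: "f x = u" if "(x, u) \<in> H" for x u
    using uniq[OF f'[OF HD(1)[OF that]] that] .
  have "f \<in> mod_hom R M E"
  proof (rule mod_homI)
    fix x assume x: "x \<in> carrier M"
    show "f x \<in> carrier E" by (rule HD(2)[OF f'[OF x]])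
    fix y assume y: "y \<in> carrier M"
    show "f (x \<oplus>\<^bsub>M\<^esub> y) = f x \<oplus>\<^bsub>E\<^esub> f y" by (rule f[OF HD(4)[OF f'[OF x] f'[OF y]]])
  next
    fix r x assume r: "r \<in> carrier R" and x: "x \<in> carrier M"
    show "f (r \<odot>\<^bsub>M\<^esub> x) = r \<odot>\<^bsub>E\<^esub> f x" by (rule f[OF HD(5)[OF r f'[OF x]]])
  qed
  then show ?thesis using f GH by (intro bexI[of _ f]) auto
qed

section \<open>The injective hull of the residue field is a cogenerator\<close>

locale matlis_duality =
  fixes R :: "('r, 'x) ring_scheme" and \<mm> :: "'r set" and E :: "('r, 'e) module"
  assumes noetherian: "noetherian_ring R"
    and local: "local_ring_with R \<mm>"
    and hull: "injective_hull R (quot_module (self_module R) \<mm>) E"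
begin

lemma cring_R: "cring R" using local unfolding local_ring_with_def by (rule conjunct1)

lemma injective_E: "injective_module R E" using hull unfolding injective_hull_def by (rule conjunct1)

lemma module_E: "module R E" using injective_E unfolding injective_module_def by (rule conjunct1)

text \<open>Every nonempty chain of ideals of a Noetherian ring contains its union, so Zorn's lemma yields
  a maximal ideal above \<open>J\<close>, and \<open>\<mm>\<close> is the only one.\<close>

lemma proper_ideal_le_maximal:
  assumes J: "ideal J R" and one: "\<one>\<^bsub>R\<^esub> \<notin> J"
  shows "J \<subseteq> \<mm>"
proof -
  interpret R: cring R by (rule cring_R)
  define \<A> where "\<A> = {I. ideal I R \<and> \<one>\<^bsub>R\<^esub> \<notin> I \<and> J \<subseteq> I}"
  have "\<exists>I\<in>\<A>. \<forall>Y\<in>\<A>. I \<subseteq> Y \<longrightarrow> Y = I"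
  proof (rule subset_Zorn_nonempty)
    have "J \<in> \<A>" using assms by (simp add: \<A>_def)
    then show "\<A> \<noteq> {}" by (metis empty_iff)
    fix \<C> assume C: "\<C> \<noteq> {}" "subset.chain \<A> \<C>"
    then have "subset.chain {I. ideal I R} \<C>" by (auto simp: subset_chain_def \<A>_def)
    then have "\<Union>\<C> \<in> \<C>"
      by (rule noetherian_ring.ideal_chain_is_trivial[OF noetherian C(1)])
    moreover have "\<C> \<subseteq> \<A>" using C(2) by (simp add: subset_chain_def)
    ultimately show "\<Union>\<C> \<in> \<A>" by (rule subsetD[rotated])
  qed
  then obtain I where IA: "I \<in> \<A>" and max: "\<forall>Y\<in>\<A>. I \<subseteq> Y \<longrightarrow> Y = I"
    by (elim bexE)
  then have I: "ideal I R" "\<one>\<^bsub>R\<^esub> \<notin> I" "J \<subseteq> I" by (simp_all add: \<A>_def)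
  have "maximalideal I R"
  proof (rule maximalidealI)
    show "carrier R \<noteq> I" using I(2) R.one_closed by metis
    fix Y assume Y: "ideal Y R" "I \<subseteq> Y" "Y \<subseteq> carrier R"
    show "Y = I \<or> Y = carrier R"
    proof (cases "\<one>\<^bsub>R\<^esub> \<in> Y")
      case True
      then show ?thesis using ideal.one_imp_carrier[OF Y(1)] by simp
    next
      case False
      then have "Y \<in> \<A>" using Y I(3) by (simp add: \<A>_def)
      then show ?thesis using max Y(2) by simp
    qed
  qed (rule I(1))
  then have "I = \<mm>" using local unfolding local_ring_with_def by blast
  then show ?thesis using I(3) by simp
qed

text \<open>Take the image in \<open>E\<close> of the residue class of \<open>1\<close>.\<close>

lemma residue_generator:
  obtains e where "e \<in> carrier E" "e \<noteq> \<zero>\<^bsub>E\<^esub>" "\<And>r. r \<in> \<mm> \<Longrightarrow> r \<odot>\<^bsub>E\<^esub> e = \<zero>\<^bsub>E\<^esub>"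
proof -
  interpret R: cring R by (rule cring_R)
  interpret E: module R E by (rule module_E)
  let ?K = "quot_module (self_module R) \<mm>"
  have mm: "maximalideal \<mm> R" using local unfolding local_ring_with_def by blast
  interpret mm: maximalideal \<mm> R by (rule mm)
  obtain \<iota> where i: "\<iota> \<in> mod_hom R ?K E" "inj_on \<iota> (carrier ?K)"
    using hull unfolding injective_hull_def by blast
  \<comment> \<open>Addition and scalar multiplication of cosets are sums of sets; for \<open>\<mm>\<close> added to itself and
    for the multiple of a coset by an element of \<open>\<mm>\<close>, these sums have the form \<open>\<mm> + W\<close>.\<close>
  have absorb: "\<mm> <+>\<^bsub>self_module R\<^esub> W = \<mm>" if W: "W \<subseteq> \<mm>" "w \<in> W" for W w
  proof
    have eq: "\<mm> <+>\<^bsub>self_module R\<^esub> W = (\<Union>h\<in>\<mm>. \<Union>k\<in>W. {h \<oplus>\<^bsub>R\<^esub> k})"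
      by (simp add: set_add_def')
    show "\<mm> <+>\<^bsub>self_module R\<^esub> W \<subseteq> \<mm>" unfolding eq using W by auto
    show "\<mm> \<subseteq> \<mm> <+>\<^bsub>self_module R\<^esub> W"
    proof
      fix c assume c: "c \<in> \<mm>"
      have w: "w \<in> \<mm>" using W by (rule subsetD)
      have "c \<oplus>\<^bsub>R\<^esub> \<ominus>\<^bsub>R\<^esub> w \<in> \<mm>" using c w by simp
      then have "(c \<oplus>\<^bsub>R\<^esub> \<ominus>\<^bsub>R\<^esub> w) \<oplus>\<^bsub>R\<^esub> w \<in> (\<Union>h\<in>\<mm>. \<Union>k\<in>W. {h \<oplus>\<^bsub>R\<^esub> k})"
        using W(2) by blast
      moreover have "(c \<oplus>\<^bsub>R\<^esub> \<ominus>\<^bsub>R\<^esub> w) \<oplus>\<^bsub>R\<^esub> w = c"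
        using subsetD[OF mm.a_subset c] subsetD[OF mm.a_subset w] by (simp add: R.a_assoc R.l_neg)
      ultimately show "c \<in> \<mm> <+>\<^bsub>self_module R\<^esub> W" unfolding eq by simp
    qed
  qed
  have coset: "\<mm> +>\<^bsub>self_module R\<^esub> x \<in> carrier ?K" if "x \<in> carrier R" for x
    using that by (auto simp: quot_module_def A_RCOSETS_def')
  have coset_eq: "\<mm> +>\<^bsub>self_module R\<^esub> x = (\<lambda>a. a \<oplus>\<^bsub>R\<^esub> x) ` \<mm>" for x
    by (auto simp: a_r_coset_def')
  have "\<mm> +>\<^bsub>self_module R\<^esub> \<zero>\<^bsub>R\<^esub> = (\<lambda>a. a) ` \<mm>"
    unfolding coset_eq using mm.a_subset by (intro image_cong) auto
  then have mK: "\<mm> \<in> carrier ?K" using coset[OF R.zero_closed] by simp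
  have "\<mm> \<oplus>\<^bsub>?K\<^esub> \<mm> = \<mm>"
    using absorb[OF subset_refl mm.zero_closed] by (simp add: quot_module_def)
  then have im: "\<iota> \<mm> = \<zero>\<^bsub>E\<^esub>"
    using mod_homD(2)[OF i(1) mK mK] mod_homD(1)[OF i(1) mK] by simp
  define u where "u = \<mm> +>\<^bsub>self_module R\<^esub> \<one>\<^bsub>R\<^esub>"
  have uK: "u \<in> carrier ?K" unfolding u_def by (rule coset[OF R.one_closed])
  have "\<one>\<^bsub>R\<^esub> \<notin> \<mm>" using mm.I_notcarr mm.one_imp_carrier by metis
  moreover have one_u: "\<one>\<^bsub>R\<^esub> \<in> u"
    unfolding u_def coset_eq using mm.zero_closed by (intro image_eqI[of _ _ "\<zero>\<^bsub>R\<^esub>"]) simp_all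
  ultimately have "u \<noteq> \<mm>" by metis
  then have "\<iota> u \<noteq> \<iota> \<mm>" using inj_onD[OF i(2) _ uK mK] by metis
  then have nz: "\<iota> u \<noteq> \<zero>\<^bsub>E\<^esub>" using im by simp
  have kill: "r \<odot>\<^bsub>E\<^esub> \<iota> u = \<zero>\<^bsub>E\<^esub>" if r: "r \<in> \<mm>" for r
  proof -
    have rc: "r \<in> carrier R" using r by (rule subsetD[OF mm.a_subset])
    have "(\<lambda>x. r \<odot>\<^bsub>self_module R\<^esub> x) ` u \<subseteq> \<mm>"
    proof (rule image_subsetI)
      fix x assume "x \<in> u"
      then have "x \<in> carrier R" unfolding u_def coset_eq using mm.a_subset by auto
      then show "r \<odot>\<^bsub>self_module R\<^esub> x \<in> \<mm>" using mm.I_r_closed[OF r] by simp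
    qed
    then have "\<mm> <+>\<^bsub>self_module R\<^esub> ((\<lambda>x. r \<odot>\<^bsub>self_module R\<^esub> x) ` u) = \<mm>"
      by (rule absorb[OF _ imageI[OF one_u]])
    then have "r \<odot>\<^bsub>?K\<^esub> u = \<mm>" by (simp add: quot_module_def)
    then show ?thesis using mod_homD(3)[OF i(1) rc uK] im by simp
  qed
  show thesis by (rule that[OF mod_homD(1)[OF i(1) uK] nz kill])
qed

text \<open>If \<open>r x\<close> lies in \<open>L\<close> then \<open>r\<close> is not a unit, so it lies in \<open>\<mm>\<close> and kills the generator
  \<open>e\<close> of the copy of the residue field in \<open>E\<close>. Hence there is a partial homomorphism that is zero on
  \<open>L\<close> and maps \<open>x\<close> to \<open>e \<noteq> 0\<close>, and it extends to all of \<open>M\<close>.\<close>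

theorem separating_functional:
  assumes M: "module R M" and L: "submodule L R M" and x: "x \<in> carrier M" "x \<notin> L"
  shows "\<exists>f\<in>mod_hom R M E. (\<forall>y\<in>L. f y = \<zero>\<^bsub>E\<^esub>) \<and> f x \<noteq> \<zero>\<^bsub>E\<^esub>"
proof -
  interpret M: module R M by fact
  interpret E: module R E by (rule module_E)
  note L' = L[unfolded submodule_iff[OF M]]
  obtain e where e: "e \<in> carrier E" "e \<noteq> \<zero>\<^bsub>E\<^esub>" "\<And>r. r \<in> \<mm> \<Longrightarrow> r \<odot>\<^bsub>E\<^esub> e = \<zero>\<^bsub>E\<^esub>"
    using residue_generator by blast
  let ?I = "{r \<in> carrier R. r \<odot>\<^bsub>M\<^esub> x \<in> L}"
  have "ideal ?I R"
  proof (rule idealI)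
    show "ring R" by (rule M.R.ring_axioms)
    show "subgroup ?I (add_monoid R)"
    proof (rule M.R.add.subgroupI)
      fix a assume a: "a \<in> ?I"
      then show "\<ominus>\<^bsub>R\<^esub> a \<in> ?I" using x M.submoduleE(3)[OF L] by (simp add: M.smult_l_minus)
    next
      show "?I \<noteq> {}" using x L' M.R.zero_closed M.smult_l_null by fastforce
    qed (use x L' in \<open>auto simp: M.smult_l_distr\<close>)
    fix a y assume "a \<in> ?I" "y \<in> carrier R"
    then show "y \<otimes>\<^bsub>R\<^esub> a \<in> ?I" "a \<otimes>\<^bsub>R\<^esub> y \<in> ?I"
      using x L' by (auto simp: M.smult_assoc1 M.R.m_comm[of a y])
  qed
  then have I: "?I \<subseteq> \<mm>" using x by (intro proper_ideal_le_maximal) simp_all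
  have G0: "partial_hom R M E (L \<times> {\<zero>\<^bsub>E\<^esub>})"
    using L' by (auto simp: partial_hom_def)
  have "\<exists>G. partial_hom R M E G \<and> L \<times> {\<zero>\<^bsub>E\<^esub>} \<subseteq> G \<and> (x, e) \<in> G"
  proof (rule partial_hom_extend[OF M module_E G0 x(1) e(1)])
    fix r u assume "r \<in> carrier R" "(r \<odot>\<^bsub>M\<^esub> x, u) \<in> L \<times> {\<zero>\<^bsub>E\<^esub>}"
    then show "u = r \<odot>\<^bsub>E\<^esub> e" using I e(3) by auto
  qed
  then obtain G where G: "partial_hom R M E G" "L \<times> {\<zero>\<^bsub>E\<^esub>} \<subseteq> G" "(x, e) \<in> G" by blast
  obtain f where "f \<in> mod_hom R M E" "\<forall>(x, u)\<in>G. f x = u"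
    using baer_extension[OF injective_E M G(1)] by blast
  then show ?thesis using G(2,3) e(2) by (intro bexI[of _ f]) auto
qed

end

section \<open>The dual module and annihilators\<close>

lemma dual_simps [simp]:
  "carrier (dual R E M) = mod_hom R M E \<inter> extensional (carrier M)"
  "\<zero>\<^bsub>dual R E M\<^esub> = (\<lambda>x\<in>carrier M. \<zero>\<^bsub>E\<^esub>)"
  "f \<oplus>\<^bsub>dual R E M\<^esub> g = (\<lambda>x\<in>carrier M. f x \<oplus>\<^bsub>E\<^esub> g x)"
  "r \<odot>\<^bsub>dual R E M\<^esub> f = (\<lambda>x\<in>carrier M. r \<odot>\<^bsub>E\<^esub> f x)"
  by (simp_all add: dual_def)

lemma mod_hom_cong:
  assumes "module R M" and "f \<in> mod_hom R M N" and "\<And>x. x \<in> carrier M \<Longrightarrow> g x = f x"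
  shows "g \<in> mod_hom R M N"
proof -
  interpret module R M by fact
  show ?thesis by (rule mod_homI) (simp_all add: assms(3) mod_homD[OF assms(2)])
qed

lemma mod_iso_cong:
  assumes "module R M" and "f \<in> mod_iso R M N" and "\<And>x. x \<in> carrier M \<Longrightarrow> f x = g x"
  shows "g \<in> mod_iso R M N"
  using mod_hom_cong[OF assms(1) mod_isoD(1)[OF assms(2)], of g] mod_isoD(2)[OF assms(2)]
    bij_betw_cong[of "carrier M" f g "carrier N"] assms(3)
  by (simp add: mod_iso_def)

lemma restrict_in_dual:
  assumes "module R M" and "f \<in> mod_hom R M E"
  shows "restrict f (carrier M) \<in> carrier (dual R E M)"
  using mod_hom_cong[OF assms, of "restrict f (carrier M)"] by simp

lemma mod_hom_add:
  assumes "module R M" and "module R E" and f: "f \<in> mod_hom R M E" and g: "g \<in> mod_hom R M E"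
  shows "(\<lambda>x. f x \<oplus>\<^bsub>E\<^esub> g x) \<in> mod_hom R M E"
proof -
  interpret M: module R M by fact
  interpret E: module R E by fact
  show ?thesis
    by (rule mod_homI) (simp_all add: mod_homD[OF f] mod_homD[OF g] E.smult_r_distr E.M.a_ac)
qed

lemma mod_hom_smult:
  assumes "module R M" and "module R E" and f: "f \<in> mod_hom R M E" and r: "r \<in> carrier R"
  shows "(\<lambda>x. r \<odot>\<^bsub>E\<^esub> f x) \<in> mod_hom R M E"
proof -
  interpret M: module R M by fact
  interpret E: module R E by fact
  show ?thesis
  proof (rule mod_homI)
    fix s x assume s: "s \<in> carrier R" and x: "x \<in> carrier M"
    then show "r \<odot>\<^bsub>E\<^esub> f (s \<odot>\<^bsub>M\<^esub> x) = s \<odot>\<^bsub>E\<^esub> (r \<odot>\<^bsub>E\<^esub> f x)"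
      using r mod_homD[OF f] by (simp add: E.smult_assoc1[symmetric] M.R.m_comm)
  qed (simp_all add: mod_homD[OF f] r E.smult_r_distr)
qed

lemma mod_hom_const_zero:
  assumes "module R M" and "module R E"
  shows "(\<lambda>x. \<zero>\<^bsub>E\<^esub>) \<in> mod_hom R M E"
proof -
  interpret M: module R M by fact
  interpret E: module R E by fact
  show ?thesis by (rule mod_homI) simp_all
qed

lemma module_dual:
  assumes M: "module R M" and E: "module R E"
  shows "module R (dual R E M)"
proof -
  interpret M: module R M by fact
  interpret E: module R E by fact
  have in_dual: "f \<in> mod_hom R M E" "f \<in> extensional (carrier M)" "\<And>x. x \<in> carrier M \<Longrightarrow> f x \<in> carrier E"
    if "f \<in> carrier (dual R E M)" for f
    using that mod_homD(1)[of f R M E] by auto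
  note add = restrict_in_dual[OF M mod_hom_add[OF M E]]
  note smult = restrict_in_dual[OF M mod_hom_smult[OF M E]]
  have ext: "f = g" if "f \<in> carrier (dual R E M)" "g \<in> carrier (dual R E M)"
    "\<And>x. x \<in> carrier M \<Longrightarrow> f x = g x" for f g
    using that in_dual(2) by (metis extensionalityI)
  show ?thesis
  proof (rule moduleI)
    show "cring R" by (rule M.R.is_cring)
    show "abelian_group (dual R E M)"
    proof (rule abelian_groupI)
      fix f g h assume f: "f \<in> carrier (dual R E M)" and g: "g \<in> carrier (dual R E M)"
      show fg: "f \<oplus>\<^bsub>dual R E M\<^esub> g \<in> carrier (dual R E M)"
        using add[OF in_dual(1)[OF f] in_dual(1)[OF g]] by simp
      show "f \<oplus>\<^bsub>dual R E M\<^esub> g = g \<oplus>\<^bsub>dual R E M\<^esub> f"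
        unfolding dual_simps using in_dual(3)[OF f] in_dual(3)[OF g] by (intro restrict_ext E.M.a_comm)
      assume h: "h \<in> carrier (dual R E M)"
      show "f \<oplus>\<^bsub>dual R E M\<^esub> g \<oplus>\<^bsub>dual R E M\<^esub> h = f \<oplus>\<^bsub>dual R E M\<^esub> (g \<oplus>\<^bsub>dual R E M\<^esub> h)"
        unfolding dual_simps using in_dual(3)[OF f] in_dual(3)[OF g] in_dual(3)[OF h]
        by (intro restrict_ext) (simp add: E.M.a_assoc)
    next
      show zero: "\<zero>\<^bsub>dual R E M\<^esub> \<in> carrier (dual R E M)"
        unfolding dual_simps(2) by (rule restrict_in_dual[OF M mod_hom_const_zero[OF M E]])
      fix f assume f: "f \<in> carrier (dual R E M)"
      show "\<zero>\<^bsub>dual R E M\<^esub> \<oplus>\<^bsub>dual R E M\<^esub> f = f"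
      proof (rule ext[OF _ f])
        show "\<zero>\<^bsub>dual R E M\<^esub> \<oplus>\<^bsub>dual R E M\<^esub> f \<in> carrier (dual R E M)"
          using add[OF in_dual(1)[OF zero] in_dual(1)[OF f]] by simp
      qed (use in_dual(3)[OF f] in simp)
      let ?g = "(\<ominus>\<^bsub>R\<^esub> \<one>\<^bsub>R\<^esub>) \<odot>\<^bsub>dual R E M\<^esub> f"
      have "?g \<in> carrier (dual R E M)" using smult[OF in_dual(1)[OF f]] by simp
      moreover have "?g \<oplus>\<^bsub>dual R E M\<^esub> f = \<zero>\<^bsub>dual R E M\<^esub>"
        unfolding dual_simps using in_dual(3)[OF f]
        by (intro restrict_ext) (simp add: E.smult_l_minus E.M.l_neg)
      ultimately show "\<exists>g\<in>carrier (dual R E M). g \<oplus>\<^bsub>dual R E M\<^esub> f = \<zero>\<^bsub>dual R E M\<^esub>"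
        by (metis (no_types))
    qed
  next
    fix a b f g assume a: "a \<in> carrier R" and f: "f \<in> carrier (dual R E M)"
    show "a \<odot>\<^bsub>dual R E M\<^esub> f \<in> carrier (dual R E M)"
      using smult[OF in_dual(1)[OF f] a] by simp
    show "a \<odot>\<^bsub>dual R E M\<^esub> (f \<oplus>\<^bsub>dual R E M\<^esub> g) = a \<odot>\<^bsub>dual R E M\<^esub> f \<oplus>\<^bsub>dual R E M\<^esub> a \<odot>\<^bsub>dual R E M\<^esub> g"
      if g: "g \<in> carrier (dual R E M)"
      unfolding dual_simps using in_dual(3)[OF f] in_dual(3)[OF g] a
      by (intro restrict_ext) (simp add: E.smult_r_distr)
    assume b: "b \<in> carrier R"
    show "(a \<oplus>\<^bsub>R\<^esub> b) \<odot>\<^bsub>dual R E M\<^esub> f = a \<odot>\<^bsub>dual R E M\<^esub> f \<oplus>\<^bsub>dual R E M\<^esub> b \<odot>\<^bsub>dual R E M\<^esub> f"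
      unfolding dual_simps using in_dual(3)[OF f] a b
      by (intro restrict_ext) (simp add: E.smult_l_distr)
    show "(a \<otimes>\<^bsub>R\<^esub> b) \<odot>\<^bsub>dual R E M\<^esub> f = a \<odot>\<^bsub>dual R E M\<^esub> (b \<odot>\<^bsub>dual R E M\<^esub> f)"
      unfolding dual_simps using in_dual(3)[OF f] a b
      by (intro restrict_ext) (simp add: E.smult_assoc1)
  next
    fix f assume f: "f \<in> carrier (dual R E M)"
    show "\<one>\<^bsub>R\<^esub> \<odot>\<^bsub>dual R E M\<^esub> f = f"
      by (rule ext[OF _ f]) (use smult[OF in_dual(1)[OF f]] in_dual(3)[OF f] in simp_all)
  qed
qed

text \<open>A functional on \<open>B\<close> that vanishes on \<open>A\<close> is constant on cosets and so factors through \<open>B/A\<close>.\<close>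

lemma quot_dual_eq:
  assumes B: "module R B" and E: "module R E" and A: "submodule A R B"
  shows "quot_dual R E A B = {f \<in> carrier (dual R E B). \<forall>a\<in>A. f a = \<zero>\<^bsub>E\<^esub>}"
proof -
  interpret B: module R B by fact
  interpret E: module R E by fact
  note A' = A[unfolded submodule_iff[OF B]]
  have Asub: "A \<subseteq> carrier B" using A' by (rule conjunct1)
  have add: "additive_subgroup A B"
    using A by (intro additive_subgroupI) (rule submodule.axioms(1))
  interpret ab: abelian_subgroup A B
    by (rule abelian_subgroupI3[OF add B.M.abelian_group_axioms])
  let ?Q = "quot_module B A"
  have Qc: "carrier ?Q = (\<lambda>x. A +>\<^bsub>B\<^esub> x) ` carrier B"
    by (auto simp: quot_module_def A_RCOSETS_def')
  have coset_eq: "A +>\<^bsub>B\<^esub> x = (\<lambda>a. a \<oplus>\<^bsub>B\<^esub> x) ` A" for x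
    by (auto simp: a_r_coset_def')
  have Qadd: "(A +>\<^bsub>B\<^esub> x) \<oplus>\<^bsub>?Q\<^esub> (A +>\<^bsub>B\<^esub> y) = A +>\<^bsub>B\<^esub> (x \<oplus>\<^bsub>B\<^esub> y)"
    if "x \<in> carrier B" "y \<in> carrier B" for x y
    using ab.a_rcos_sum[OF that] by (simp add: quot_module_def)
  have Qsmult: "r \<odot>\<^bsub>?Q\<^esub> (A +>\<^bsub>B\<^esub> x) = A +>\<^bsub>B\<^esub> (r \<odot>\<^bsub>B\<^esub> x)"
    if r: "r \<in> carrier R" and x: "x \<in> carrier B" for r x
  proof -
    have "r \<odot>\<^bsub>?Q\<^esub> (A +>\<^bsub>B\<^esub> x) = (\<Union>h\<in>A. \<Union>a\<in>A. {h \<oplus>\<^bsub>B\<^esub> r \<odot>\<^bsub>B\<^esub> (a \<oplus>\<^bsub>B\<^esub> x)})"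
      by (simp add: quot_module_def set_add_def' coset_eq)
    also have "\<dots> = (\<lambda>a. a \<oplus>\<^bsub>B\<^esub> r \<odot>\<^bsub>B\<^esub> x) ` A"
    proof
      show "(\<Union>h\<in>A. \<Union>a\<in>A. {h \<oplus>\<^bsub>B\<^esub> r \<odot>\<^bsub>B\<^esub> (a \<oplus>\<^bsub>B\<^esub> x)}) \<subseteq> (\<lambda>a. a \<oplus>\<^bsub>B\<^esub> r \<odot>\<^bsub>B\<^esub> x) ` A"
      proof clarify
        fix h a assume h: "h \<in> A" and a: "a \<in> A"
        have "h \<oplus>\<^bsub>B\<^esub> r \<odot>\<^bsub>B\<^esub> (a \<oplus>\<^bsub>B\<^esub> x) = (h \<oplus>\<^bsub>B\<^esub> r \<odot>\<^bsub>B\<^esub> a) \<oplus>\<^bsub>B\<^esub> r \<odot>\<^bsub>B\<^esub> x"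
          using r x subsetD[OF Asub h] subsetD[OF Asub a] by (simp add: B.smult_r_distr B.M.a_assoc)
        moreover have "h \<oplus>\<^bsub>B\<^esub> r \<odot>\<^bsub>B\<^esub> a \<in> A" using h a r A' by simp
        ultimately show "h \<oplus>\<^bsub>B\<^esub> r \<odot>\<^bsub>B\<^esub> (a \<oplus>\<^bsub>B\<^esub> x) \<in> (\<lambda>a. a \<oplus>\<^bsub>B\<^esub> r \<odot>\<^bsub>B\<^esub> x) ` A"
          by (rule image_eqI)
      qed
      show "(\<lambda>a. a \<oplus>\<^bsub>B\<^esub> r \<odot>\<^bsub>B\<^esub> x) ` A \<subseteq> (\<Union>h\<in>A. \<Union>a\<in>A. {h \<oplus>\<^bsub>B\<^esub> r \<odot>\<^bsub>B\<^esub> (a \<oplus>\<^bsub>B\<^esub> x)})"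
      proof clarify
        fix a assume a: "a \<in> A"
        have "a \<oplus>\<^bsub>B\<^esub> r \<odot>\<^bsub>B\<^esub> (\<zero>\<^bsub>B\<^esub> \<oplus>\<^bsub>B\<^esub> x) \<in> (\<Union>h\<in>A. \<Union>a\<in>A. {h \<oplus>\<^bsub>B\<^esub> r \<odot>\<^bsub>B\<^esub> (a \<oplus>\<^bsub>B\<^esub> x)})"
          using a ab.zero_closed by blast
        then show "a \<oplus>\<^bsub>B\<^esub> r \<odot>\<^bsub>B\<^esub> x \<in> (\<Union>h\<in>A. \<Union>a\<in>A. {h \<oplus>\<^bsub>B\<^esub> r \<odot>\<^bsub>B\<^esub> (a \<oplus>\<^bsub>B\<^esub> x)})"
          using x by simp
      qed
    qed
    finally show ?thesis by (simp add: coset_eq)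
  qed
  have self: "x \<in> A +>\<^bsub>B\<^esub> x" if "x \<in> carrier B" for x
    by (rule ab.a_rcos_self[OF that])
  show ?thesis
  proof (intro equalityI subsetI)
    fix g assume "g \<in> quot_dual R E A B"
    then obtain f where f: "f \<in> mod_hom R ?Q E" and g: "g = (\<lambda>x\<in>carrier B. f (A +>\<^bsub>B\<^esub> x))"
      by (auto simp: quot_dual_def)
    have "(\<lambda>x. f (A +>\<^bsub>B\<^esub> x)) \<in> mod_hom R B E"
    proof (rule mod_homI)
      fix x assume x: "x \<in> carrier B"
      show "f (A +>\<^bsub>B\<^esub> x) \<in> carrier E" by (rule mod_homD(1)[OF f]) (simp add: Qc x)
      fix y assume y: "y \<in> carrier B"
      show "f (A +>\<^bsub>B\<^esub> (x \<oplus>\<^bsub>B\<^esub> y)) = f (A +>\<^bsub>B\<^esub> x) \<oplus>\<^bsub>E\<^esub> f (A +>\<^bsub>B\<^esub> y)"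
        using mod_homD(2)[OF f, of "A +>\<^bsub>B\<^esub> x" "A +>\<^bsub>B\<^esub> y"] x y by (simp add: Qc Qadd)
    next
      fix r x assume "r \<in> carrier R" "x \<in> carrier B"
      then show "f (A +>\<^bsub>B\<^esub> (r \<odot>\<^bsub>B\<^esub> x)) = r \<odot>\<^bsub>E\<^esub> f (A +>\<^bsub>B\<^esub> x)"
        using mod_homD(3)[OF f, of r "A +>\<^bsub>B\<^esub> x"] by (simp add: Qc Qsmult)
    qed
    note hom = this
    have gd: "g \<in> carrier (dual R E B)" unfolding g by (rule restrict_in_dual[OF B hom])
    have "g a = \<zero>\<^bsub>E\<^esub>" if a: "a \<in> A" for a
    proof -
      have "A +>\<^bsub>B\<^esub> a = A +>\<^bsub>B\<^esub> \<zero>\<^bsub>B\<^esub>"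
        using ab.a_rcos_const[OF a] B.M.a_coset_add_zero[OF Asub] by simp
      then have "g a = f (A +>\<^bsub>B\<^esub> \<zero>\<^bsub>B\<^esub>)" using g subsetD[OF Asub a] by simp
      also have "\<dots> = \<zero>\<^bsub>E\<^esub>" using mod_hom_zero[OF B E hom] .
      finally show ?thesis .
    qed
    then show "g \<in> {f \<in> carrier (dual R E B). \<forall>a\<in>A. f a = \<zero>\<^bsub>E\<^esub>}" using gd by simp
  next
    fix g assume "g \<in> {f \<in> carrier (dual R E B). \<forall>a\<in>A. f a = \<zero>\<^bsub>E\<^esub>}"
    then have g: "g \<in> mod_hom R B E" "g \<in> extensional (carrier B)" and gA: "\<And>a. a \<in> A \<Longrightarrow> g a = \<zero>\<^bsub>E\<^esub>"
      by auto
    have const: "g z = g x" if x: "x \<in> carrier B" and z: "z \<in> A +>\<^bsub>B\<^esub> x" for x z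
    proof -
      obtain a where a: "a \<in> A" "z = a \<oplus>\<^bsub>B\<^esub> x" using z unfolding coset_eq by (elim imageE)
      then show ?thesis
        using gA[OF a(1)] subsetD[OF Asub a(1)] x by (simp add: mod_homD[OF g(1)])
    qed
    \<comment> \<open>By \<open>const\<close>, the choice of a representative of the coset does not matter.\<close>
    define f where "f = (\<lambda>S\<in>carrier ?Q. g (SOME z. z \<in> S))"
    have f: "f (A +>\<^bsub>B\<^esub> x) = g x" if x: "x \<in> carrier B" for x
      unfolding f_def using const[OF x someI[of "\<lambda>z. z \<in> A +>\<^bsub>B\<^esub> x", OF self[OF x]]] x by (simp add: Qc)
    have "f \<in> mod_hom R ?Q E"
    proof (rule mod_homI)
      fix S assume "S \<in> carrier ?Q"
      then obtain x where x: "x \<in> carrier B" "S = A +>\<^bsub>B\<^esub> x" unfolding Qc by (elim imageE)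
      then show "f S \<in> carrier E" using f mod_homD(1)[OF g(1)] by simp
      fix T assume "T \<in> carrier ?Q"
      then obtain y where "y \<in> carrier B" "T = A +>\<^bsub>B\<^esub> y" unfolding Qc by (elim imageE)
      then show "f (S \<oplus>\<^bsub>?Q\<^esub> T) = f S \<oplus>\<^bsub>E\<^esub> f T"
        using x f mod_homD(2)[OF g(1)] by (simp add: Qadd)
    next
      fix r S assume r: "r \<in> carrier R" and "S \<in> carrier ?Q"
      then obtain x where x: "x \<in> carrier B" "S = A +>\<^bsub>B\<^esub> x" unfolding Qc by (elim imageE)
      then show "f (r \<odot>\<^bsub>?Q\<^esub> S) = r \<odot>\<^bsub>E\<^esub> f S"
        using r f mod_homD(3)[OF g(1)] by (simp add: Qsmult)
    qed
    then have "f \<in> carrier (dual R E ?Q)" by (simp add: f_def)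
    moreover have "g = (\<lambda>x\<in>carrier B. f (A +>\<^bsub>B\<^esub> x))"
      using g(2) f by (intro extensionalityI[of g "carrier B"]) simp_all
    ultimately show "g \<in> quot_dual R E A B"
      unfolding quot_dual_def by (intro image_eqI)
  qed
qed

section \<open>Perfect pairings\<close>

lemma mod_hom_funcset: "f \<in> mod_hom R M N \<Longrightarrow> f \<in> carrier M \<rightarrow> carrier N"
  by (simp add: mod_hom_def)

text \<open>Both induced maps \<open>M \<rightarrow> N\<^sup>\<or>\<close> and \<open>N \<rightarrow> M\<^sup>\<or>\<close> are required to be surjective only. Over a
  cogenerator they are then injective as well, see \<open>pairing_separates\<close> below. The modules may live
  on different types, and the notion is symmetric in them, which the pair consisting of a module and
  its dual is not.\<close>

definition perfect_pairing ::
  "('r, 'x) ring_scheme \<Rightarrow> ('r, 'e) module \<Rightarrow> ('r, 'a) module \<Rightarrow> ('r, 'b) module \<Rightarrow>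
   ('a \<Rightarrow> 'b \<Rightarrow> 'e) \<Rightarrow> bool"
  where "perfect_pairing R E M N \<beta> \<longleftrightarrow> module R M \<and> module R N \<and>
    (\<forall>x\<in>carrier M. (\<lambda>y. \<beta> x y) \<in> mod_hom R N E) \<and>
    (\<forall>y\<in>carrier N. (\<lambda>x. \<beta> x y) \<in> mod_hom R M E) \<and>
    (\<forall>f\<in>mod_hom R N E. \<exists>x\<in>carrier M. \<forall>y\<in>carrier N. \<beta> x y = f y) \<and>
    (\<forall>f\<in>mod_hom R M E. \<exists>y\<in>carrier N. \<forall>x\<in>carrier M. \<beta> x y = f x)"

definition perp ::
  "('r, 'e) module \<Rightarrow> ('a \<Rightarrow> 'b \<Rightarrow> 'e) \<Rightarrow> ('r, 'b) module \<Rightarrow> 'a set \<Rightarrow> 'b set"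
  where "perp E \<beta> N A = {y \<in> carrier N. \<forall>x\<in>A. \<beta> x y = \<zero>\<^bsub>E\<^esub>}"

abbreviation (input) flip :: "('a \<Rightarrow> 'b \<Rightarrow> 'c) \<Rightarrow> 'b \<Rightarrow> 'a \<Rightarrow> 'c"
  where "flip \<beta> \<equiv> \<lambda>y x. \<beta> x y"

lemma perfect_pairing_flip:
  "perfect_pairing R E M N \<beta> \<Longrightarrow> perfect_pairing R E N M (flip \<beta>)"
  by (simp add: perfect_pairing_def)

lemma perfect_pairingD:
  assumes "perfect_pairing R E M N \<beta>"
  shows "module R M" and "module R N"
    and "x \<in> carrier M \<Longrightarrow> \<beta> x \<in> mod_hom R N E"
    and "y \<in> carrier N \<Longrightarrow> flip \<beta> y \<in> mod_hom R M E"
    and "f \<in> mod_hom R N E \<Longrightarrow> \<exists>x\<in>carrier M. \<forall>y\<in>carrier N. \<beta> x y = f y"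
    and "g \<in> mod_hom R M E \<Longrightarrow> \<exists>y\<in>carrier N. \<forall>x\<in>carrier M. \<beta> x y = g x"
  using assms by (simp_all add: perfect_pairing_def)

lemma perp_carrier: "perp E \<beta> N A \<subseteq> carrier N"
  by (simp add: perp_def)

lemma perp_antimono: "A \<subseteq> B \<Longrightarrow> perp E \<beta> N B \<subseteq> perp E \<beta> N A"
  by (auto simp: perp_def)

definition adjoint ::
  "('r, 'a) module \<Rightarrow> ('r, 'd) module \<Rightarrow> ('a \<Rightarrow> 'b \<Rightarrow> 'e) \<Rightarrow> ('c \<Rightarrow> 'd \<Rightarrow> 'e) \<Rightarrow>
   ('a \<Rightarrow> 'c) \<Rightarrow> ('d \<Rightarrow> 'b) \<Rightarrow> bool"
  where "adjoint M N' \<beta> \<beta>' g h \<longleftrightarrow> (\<forall>x\<in>carrier M. \<forall>y\<in>carrier N'. \<beta> x (h y) = \<beta>' (g x) y)"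

lemma adjoint_flip:
  "adjoint M N' \<beta> \<beta>' g h \<Longrightarrow> adjoint N' M (flip \<beta>') (flip \<beta>) h g"
  by (simp add: adjoint_def)

lemma perp_image:
  assumes "adjoint M N' \<beta> \<beta>' g h" and "h \<in> carrier N' \<rightarrow> carrier N" and "A \<subseteq> carrier M"
  shows "perp E \<beta>' N' (g ` A) = {y \<in> carrier N'. h y \<in> perp E \<beta> N A}"
proof -
  have "\<beta>' (g x) y = \<beta> x (h y)" if "x \<in> A" "y \<in> carrier N'" for x y
    using assms(1,3) that by (simp add: adjoint_def subset_iff)
  then show ?thesis
    using funcset_mem[OF assms(2)] by (simp add: perp_def cong: conj_cong)
qed

context matlis_duality begin

lemma perfect_pairing_zero:
  assumes "perfect_pairing R E M N \<beta>"
  shows "x \<in> carrier M \<Longrightarrow> \<beta> x \<zero>\<^bsub>N\<^esub> = \<zero>\<^bsub>E\<^esub>"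
  using mod_hom_zero[OF perfect_pairingD(2)[OF assms] module_E perfect_pairingD(3)[OF assms]] .

lemma perp_submodule:
  assumes \<beta>: "perfect_pairing R E M N \<beta>" and A: "A \<subseteq> carrier M"
  shows "submodule (perp E \<beta> N A) R N"
proof -
  interpret E: module R E by (rule module_E)
  interpret N: module R N by (rule perfect_pairingD(2)[OF \<beta>])
  have hom: "\<beta> x \<in> mod_hom R N E" if "x \<in> A" for x
    by (rule perfect_pairingD(3)[OF \<beta> subsetD[OF A that]])
  show ?thesis
    unfolding submodule_iff[OF perfect_pairingD(2)[OF \<beta>]]
    using perfect_pairing_zero[OF \<beta> subsetD[OF A]]
    by (simp add: perp_def mod_homD[OF hom])
qed

text \<open>A nonzero \<open>y\<close> is detected by some functional on \<open>N\<close>, and every such functional is pairing with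
  an element of \<open>M\<close>.\<close>

lemma pairing_separates:
  assumes \<beta>: "perfect_pairing R E M N \<beta>" and y: "y \<in> carrier N"
    and zero: "\<And>x. x \<in> carrier M \<Longrightarrow> \<beta> x y = \<zero>\<^bsub>E\<^esub>"
  shows "y = \<zero>\<^bsub>N\<^esub>"
proof (rule ccontr)
  assume ne: "y \<noteq> \<zero>\<^bsub>N\<^esub>"
  have N: "module R N" by (rule perfect_pairingD(2)[OF \<beta>])
  interpret N: module R N by (rule N)
  have "submodule {\<zero>\<^bsub>N\<^esub>} R N" by (simp add: submodule_iff[OF N])
  then obtain f where f: "f \<in> mod_hom R N E" "f y \<noteq> \<zero>\<^bsub>E\<^esub>"
    using separating_functional[OF N _ y] ne by (metis singletonD)
  obtain x where "x \<in> carrier M" "\<forall>y\<in>carrier N. \<beta> x y = f y"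
    using perfect_pairingD(5)[OF \<beta> f(1)] by (elim bexE)
  then show False using zero y f(2) by metis
qed

lemma pairing_eqI:
  assumes \<beta>: "perfect_pairing R E M N \<beta>" and y: "y \<in> carrier N" and z: "z \<in> carrier N"
    and eq: "\<And>x. x \<in> carrier M \<Longrightarrow> \<beta> x y = \<beta> x z"
  shows "y = z"
proof -
  interpret E: module R E by (rule module_E)
  have N: "module R N" by (rule perfect_pairingD(2)[OF \<beta>])
  interpret N: module R N by (rule N)
  have "y \<ominus>\<^bsub>N\<^esub> z = \<zero>\<^bsub>N\<^esub>"
  proof (rule pairing_separates[OF \<beta>])
    fix x assume x: "x \<in> carrier M"
    note hom = perfect_pairingD(3)[OF \<beta> x]
    show "\<beta> x (y \<ominus>\<^bsub>N\<^esub> z) = \<zero>\<^bsub>E\<^esub>"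
      using mod_hom_minus[OF N module_E hom y z] eq[OF x] mod_homD(1)[OF hom z]
      by (simp add: a_minus_def E.M.r_neg)
  qed (use y z in simp)
  then show ?thesis by (rule N.M.eq_if_minus_eq_zero[OF y z])
qed

text \<open>An element outside \<open>A\<close> is separated from \<open>A\<close> by a functional, and this functional is pairing
  with an element of the annihilator of \<open>A\<close>.\<close>

lemma perp_perp:
  assumes \<beta>: "perfect_pairing R E M N \<beta>" and A: "submodule A R M"
  shows "perp E (flip \<beta>) M (perp E \<beta> N A) = A"
proof
  have M: "module R M" by (rule perfect_pairingD(1)[OF \<beta>])
  have Asub: "A \<subseteq> carrier M" using A submodule_iff[OF M] by metis
  show "A \<subseteq> perp E (flip \<beta>) M (perp E \<beta> N A)"
    using Asub by (auto simp: perp_def)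
  show "perp E (flip \<beta>) M (perp E \<beta> N A) \<subseteq> A"
  proof (rule subsetI, rule ccontr)
    fix x assume x: "x \<in> perp E (flip \<beta>) M (perp E \<beta> N A)" "x \<notin> A"
    then have xM: "x \<in> carrier M" by (simp add: perp_def)
    obtain f where f: "f \<in> mod_hom R M E" "\<forall>y\<in>A. f y = \<zero>\<^bsub>E\<^esub>" "f x \<noteq> \<zero>\<^bsub>E\<^esub>"
      using separating_functional[OF M A xM x(2)] by (elim bexE conjE)
    obtain y where y: "y \<in> carrier N" "\<forall>x\<in>carrier M. \<beta> x y = f x"
      using perfect_pairingD(6)[OF \<beta> f(1)] by (elim bexE)
    have "y \<in> perp E \<beta> N A" using y f(2) Asub by (simp add: perp_def subset_iff)
    then have "\<beta> x y = \<zero>\<^bsub>E\<^esub>" using x(1) by (simp add: perp_def)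
    then show False using y(2) xM f(3) by simp
  qed
qed

lemma perp_zero:
  assumes \<beta>: "perfect_pairing R E M N \<beta>"
  shows "perp E \<beta> N {\<zero>\<^bsub>M\<^esub>} = carrier N"
  using perfect_pairing_zero[OF perfect_pairing_flip[OF \<beta>]] by (auto simp: perp_def)

text \<open>For fixed \<open>y\<close> the functional \<open>x \<mapsto> \<beta>'(g x, y)\<close> is represented by a unique element \<open>h y\<close> of \<open>N\<close>;
  uniqueness makes \<open>h\<close> linear.\<close>

lemma adjoint_exists:
  assumes \<beta>: "perfect_pairing R E M N \<beta>" and \<beta>': "perfect_pairing R E M' N' \<beta>'"
    and g: "g \<in> mod_hom R M M'"
  obtains h where "h \<in> mod_hom R N' N" and "adjoint M N' \<beta> \<beta>' g h"
proof -
  interpret N: module R N by (rule perfect_pairingD(2)[OF \<beta>])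
  interpret N': module R N' by (rule perfect_pairingD(2)[OF \<beta>'])
  have "\<exists>z. z \<in> carrier N \<and> (\<forall>x\<in>carrier M. \<beta> x z = \<beta>' (g x) y)" if y: "y \<in> carrier N'" for y
    using perfect_pairingD(6)[OF \<beta> mod_hom_comp[OF g perfect_pairingD(4)[OF \<beta>' y]]] by auto
  then obtain h where h: "\<And>y. y \<in> carrier N' \<Longrightarrow> h y \<in> carrier N"
    "\<And>x y. y \<in> carrier N' \<Longrightarrow> x \<in> carrier M \<Longrightarrow> \<beta> x (h y) = \<beta>' (g x) y"
    by metis
  have \<beta>_hom: "\<beta> x \<in> mod_hom R N E" if "x \<in> carrier M" for x
    by (rule perfect_pairingD(3)[OF \<beta> that])
  have \<beta>'_hom: "\<beta>' (g x) \<in> mod_hom R N' E" if "x \<in> carrier M" for x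
    by (rule perfect_pairingD(3)[OF \<beta>' mod_homD(1)[OF g that]])
  have "h \<in> mod_hom R N' N"
  proof (rule mod_homI)
    fix y z assume yz: "y \<in> carrier N'" "z \<in> carrier N'"
    show "h (y \<oplus>\<^bsub>N'\<^esub> z) = h y \<oplus>\<^bsub>N\<^esub> h z"
      by (rule pairing_eqI[OF \<beta>]) (simp_all add: h yz mod_homD[OF \<beta>_hom] mod_homD[OF \<beta>'_hom])
  next
    fix r y assume ry: "r \<in> carrier R" "y \<in> carrier N'"
    show "h (r \<odot>\<^bsub>N'\<^esub> y) = r \<odot>\<^bsub>N\<^esub> h y"
      by (rule pairing_eqI[OF \<beta>]) (simp_all add: h ry mod_homD[OF \<beta>_hom] mod_homD[OF \<beta>'_hom])
  qed (rule h)
  then show thesis using that h(2) by (simp add: adjoint_def)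
qed

lemma perfect_pairing_iso:
  assumes \<beta>: "perfect_pairing R E M N \<beta>" and M': "module R M'" and f: "f \<in> mod_iso R M M'"
  shows "perfect_pairing R E M' N (\<lambda>x. \<beta> (inv_into (carrier M) f x))"
proof -
  let ?g = "inv_into (carrier M) f"
  have g: "?g \<in> mod_hom R M' M"
    by (rule mod_isoD(1)[OF mod_iso_inv[OF perfect_pairingD(1)[OF \<beta>] f]])
  show ?thesis
    unfolding perfect_pairing_def
  proof (intro conjI ballI)
    show "\<beta> (?g x) \<in> mod_hom R N E" if "x \<in> carrier M'" for x
      by (rule perfect_pairingD(3)[OF \<beta> mod_homD(1)[OF g that]])
    show "(\<lambda>x. \<beta> (?g x) y) \<in> mod_hom R M' E" if "y \<in> carrier N" for y
      by (rule mod_hom_comp[OF g perfect_pairingD(4)[OF \<beta> that]])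
  next
    fix u assume "u \<in> mod_hom R N E"
    then obtain x where x: "x \<in> carrier M" "\<forall>y\<in>carrier N. \<beta> x y = u y"
      using perfect_pairingD(5)[OF \<beta>] by metis
    show "\<exists>x\<in>carrier M'. \<forall>y\<in>carrier N. \<beta> (?g x) y = u y"
      using x mod_homD(1)[OF mod_isoD(1)[OF f]] mod_isoD(3)[OF f]
      by (intro bexI[of _ "f x"]) simp_all
  next
    fix u assume u: "u \<in> mod_hom R M' E"
    obtain y where y: "y \<in> carrier N" "\<forall>x\<in>carrier M. \<beta> x y = u (f x)"
      using perfect_pairingD(6)[OF \<beta> mod_hom_comp[OF mod_isoD(1)[OF f] u]] by (elim bexE)
    have "f (?g x) = x" if "x \<in> carrier M'" for x
      using that mod_isoD(4)[OF f] by (simp add: f_inv_into_f)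
    then show "\<exists>y\<in>carrier N. \<forall>x\<in>carrier M'. \<beta> (?g x) y = u x"
      using y mod_homD(1)[OF g] by (intro bexI[of _ y]) simp_all
  qed (rule M' perfect_pairingD(2)[OF \<beta>])+
qed

lemma perfect_pairing_dual:
  assumes M: "module R M" and "matlis_dualizable R E M"
  shows "perfect_pairing R E M (dual R E M) (\<lambda>x f. f x)"
proof -
  let ?D = "dual R E M"
  have D: "module R ?D" by (rule module_dual[OF M module_E])
  interpret M: module R M by (rule M)
  interpret D: module R ?D by (rule D)
  have ev: "eval_map R E M ` carrier M = carrier (dual R E ?D)"
    using assms(2) unfolding matlis_dualizable_def by (rule mod_isoD(4))
  show ?thesis
    unfolding perfect_pairing_def
  proof (intro conjI ballI)
    fix x assume x: "x \<in> carrier M"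
    show "(\<lambda>f. f x) \<in> mod_hom R ?D E"
      by (rule mod_homI) (use x in \<open>auto simp: mod_homD(1)\<close>)
  next
    fix u assume u: "u \<in> mod_hom R ?D E"
    have "restrict u (carrier ?D) \<in> eval_map R E M ` carrier M"
      unfolding ev by (rule restrict_in_dual[OF D u])
    then obtain x where x: "x \<in> carrier M" "restrict u (carrier ?D) = eval_map R E M x"
      by (elim imageE)
    have "f x = u f" if "f \<in> carrier ?D" for f
      using fun_cong[OF x(2), of f] that by (simp add: eval_map_def)
    then show "\<exists>x\<in>carrier M. \<forall>f\<in>carrier ?D. f x = u f" using x(1) by metis
  next
    fix u assume "u \<in> mod_hom R M E"
    then show "\<exists>f\<in>carrier ?D. \<forall>x\<in>carrier M. f x = u x"
      by (intro bexI[OF _ restrict_in_dual[OF M]]) simp_all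
  qed (use M D in simp_all)
qed

lemma pairing_iso_dual:
  assumes \<beta>: "perfect_pairing R E M N \<beta>"
  shows "(\<lambda>y. \<lambda>x\<in>carrier M. \<beta> x y) \<in> mod_iso R N (dual R E M)"
proof -
  have M: "module R M" by (rule perfect_pairingD(1)[OF \<beta>])
  interpret M: module R M by (rule M)
  interpret N: module R N by (rule perfect_pairingD(2)[OF \<beta>])
  let ?\<tau> = "\<lambda>y. \<lambda>x\<in>carrier M. \<beta> x y"
  have hom: "\<beta> x \<in> mod_hom R N E" if "x \<in> carrier M" for x
    by (rule perfect_pairingD(3)[OF \<beta> that])
  have closed: "?\<tau> y \<in> carrier (dual R E M)" if "y \<in> carrier N" for y
    by (rule restrict_in_dual[OF M perfect_pairingD(4)[OF \<beta> that]])
  have "?\<tau> \<in> mod_hom R N (dual R E M)"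
  proof (rule mod_homI)
    fix y z assume "y \<in> carrier N" "z \<in> carrier N"
    then show "?\<tau> (y \<oplus>\<^bsub>N\<^esub> z) = ?\<tau> y \<oplus>\<^bsub>dual R E M\<^esub> ?\<tau> z"
      unfolding dual_simps by (intro restrict_ext) (simp add: mod_homD[OF hom])
  next
    fix r y assume "r \<in> carrier R" "y \<in> carrier N"
    then show "?\<tau> (r \<odot>\<^bsub>N\<^esub> y) = r \<odot>\<^bsub>dual R E M\<^esub> ?\<tau> y"
      unfolding dual_simps by (intro restrict_ext) (simp add: mod_homD[OF hom])
  qed (rule closed)
  moreover have "inj_on ?\<tau> (carrier N)"
  proof (rule inj_onI)
    fix y z assume yz: "y \<in> carrier N" "z \<in> carrier N" and eq: "?\<tau> y = ?\<tau> z"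
    show "y = z"
    proof (rule pairing_eqI[OF \<beta> yz])
      show "\<beta> x y = \<beta> x z" if "x \<in> carrier M" for x using fun_cong[OF eq, of x] that by simp
    qed
  qed
  moreover have "?\<tau> ` carrier N = carrier (dual R E M)"
  proof
    show "?\<tau> ` carrier N \<subseteq> carrier (dual R E M)" by (rule image_subsetI) (rule closed)
    show "carrier (dual R E M) \<subseteq> ?\<tau> ` carrier N"
    proof
      fix f assume "f \<in> carrier (dual R E M)"
      then have f: "f \<in> mod_hom R M E" "f \<in> extensional (carrier M)" by simp_all
      obtain y where y: "y \<in> carrier N" "\<forall>x\<in>carrier M. \<beta> x y = f x"
        using perfect_pairingD(6)[OF \<beta> f(1)] by (elim bexE)
      then have "f = ?\<tau> y" using f(2) by (intro extensionalityI[of f "carrier M"]) simp_all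
      then show "f \<in> ?\<tau> ` carrier N" using y(1) by (rule image_eqI)
    qed
  qed
  ultimately show ?thesis by (simp add: mod_iso_def bij_betw_def)
qed

lemma pairing_iso_dual_perp:
  assumes \<beta>: "perfect_pairing R E M N \<beta>" and A: "submodule A R M"
  shows "(\<lambda>y. \<lambda>x\<in>carrier M. \<beta> x y) ` perp E \<beta> N A = quot_dual R E A M"
proof -
  have M: "module R M" by (rule perfect_pairingD(1)[OF \<beta>])
  have Asub: "A \<subseteq> carrier M" using A submodule_iff[OF M] by metis
  let ?\<tau> = "\<lambda>y. \<lambda>x\<in>carrier M. \<beta> x y"
  have im: "?\<tau> ` carrier N = carrier (dual R E M)" by (rule mod_isoD(4)[OF pairing_iso_dual[OF \<beta>]])
  have iff: "(\<forall>a\<in>A. ?\<tau> y a = \<zero>\<^bsub>E\<^esub>) \<longleftrightarrow> (\<forall>a\<in>A. \<beta> a y = \<zero>\<^bsub>E\<^esub>)" for y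
    using Asub by (intro ball_cong) (auto simp: subset_iff)
  have "quot_dual R E A M = {f \<in> ?\<tau> ` carrier N. \<forall>a\<in>A. f a = \<zero>\<^bsub>E\<^esub>}"
    by (simp only: quot_dual_eq[OF M module_E A] im)
  also have "\<dots> = ?\<tau> ` {y \<in> carrier N. \<forall>a\<in>A. ?\<tau> y a = \<zero>\<^bsub>E\<^esub>}"
    by blast
  finally show ?thesis by (simp only: iff perp_def)
qed

text \<open>Replacing \<open>N\<close> by the isomorphic module \<open>M\<^sup>\<or>\<close> turns \<open>\<beta>\<close> into a perfect pairing of \<open>M\<^sup>\<or>\<close> with
  \<open>M\<close>, and the isomorphism \<open>M \<rightarrow> M\<^sup>\<or>\<^sup>\<or>\<close> that it induces is evaluation.\<close>

lemma dualizable_if_perfect_pairing: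
  assumes \<beta>: "perfect_pairing R E M N \<beta>"
  shows "matlis_dualizable R E M"
proof -
  let ?D = "dual R E M"
  let ?\<tau> = "\<lambda>y. \<lambda>x\<in>carrier M. \<beta> x y"
  have M: "module R M" by (rule perfect_pairingD(1)[OF \<beta>])
  have D: "module R ?D" by (rule module_dual[OF M module_E])
  note iso = pairing_iso_dual[OF \<beta>]
  have "perfect_pairing R E ?D M (\<lambda>f. flip \<beta> (inv_into (carrier N) ?\<tau> f))"
    by (rule perfect_pairing_iso[OF perfect_pairing_flip[OF \<beta>] D iso])
  then have "perfect_pairing R E M ?D (\<lambda>x f. \<beta> x (inv_into (carrier N) ?\<tau> f))"
    by (rule perfect_pairing_flip)
  note D_pairing = perfect_pairing_flip[OF this]
  have eq: "\<beta> x (inv_into (carrier N) ?\<tau> f) = f x" if f: "f \<in> carrier ?D" and x: "x \<in> carrier M" for f x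
  proof -
    have "?\<tau> (inv_into (carrier N) ?\<tau> f) = f"
      by (rule f_inv_into_f) (use f in \<open>simp only: mod_isoD(4)[OF iso]\<close>)
    then have "?\<tau> (inv_into (carrier N) ?\<tau> f) x = f x" by (rule fun_cong)
    then show ?thesis using x by simp
  qed
  have "(\<lambda>x. \<lambda>f\<in>carrier ?D. \<beta> x (inv_into (carrier N) ?\<tau> f)) \<in> mod_iso R M (dual R E ?D)"
    by (rule pairing_iso_dual[OF D_pairing])
  moreover have "(\<lambda>f\<in>carrier ?D. \<beta> x (inv_into (carrier N) ?\<tau> f)) = eval_map R E M x"
    if "x \<in> carrier M" for x
    unfolding eval_map_def by (rule restrict_ext) (rule eq[OF _ that])
  ultimately show ?thesis
    unfolding matlis_dualizable_def by (rule mod_iso_cong[OF M])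
qed

end

section \<open>Pair operations dual to each other\<close>

lemma pair_operationD:
  assumes "pair_operation R P p" and "(L, M) \<in> P"
  shows "module R M" and "submodule L R M" and "submodule (p L M) R M"
    and "f \<in> mod_iso R M M' \<Longrightarrow> module R M' \<Longrightarrow> (f ` L, M') \<in> P"
    and "f \<in> mod_iso R M M' \<Longrightarrow> module R M' \<Longrightarrow> f ` p L M = p (f ` L) M'"
  using assms unfolding pair_operation_def pair_class_def by fastforce+

lemma submodule_subset:
  "module R M \<Longrightarrow> submodule L R M \<Longrightarrow> L \<subseteq> carrier M"
  using submodule_iff by metis

lemma image_comp_inv_into:
  assumes "f ` L = g ` K" and "inj_on f A" and "L \<subseteq> A"
  shows "(\<lambda>x. inv_into A f (g x)) ` K = L"
proof -
  have "(\<lambda>x. inv_into A f (g x)) ` K = inv_into A f ` f ` L"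
    by (simp only: assms(1) image_image[of "inv_into A f" g])
  also have "\<dots> = L" by (rule inv_into_image_cancel[OF assms(2,3)])
  finally show ?thesis .
qed

text \<open>Two isomorphisms onto \<open>M'\<close> differ by an isomorphism between their sources, and a pair operation
  respects isomorphisms. This is why neither membership nor, in the lemma after this one, the
  transported value depends on the isomorphism used.\<close>

lemma transport_pairs_iff:
  assumes P: "pair_operation R P p" and M: "module R M" and L: "L \<subseteq> carrier M"
    and f: "f \<in> mod_iso R M M'" and M': "module R M'"
  shows "(f ` L, M') \<in> transport_pairs R P \<longleftrightarrow> (L, M) \<in> P"
proof
  assume "(L, M) \<in> P"
  then show "(f ` L, M') \<in> transport_pairs R P"
    unfolding transport_pairs_def using f M' by blast
next
  assume "(f ` L, M') \<in> transport_pairs R P"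
  then obtain K N g where g: "(K, N) \<in> P" "g \<in> mod_iso R N M'" "f ` L = g ` K"
    unfolding transport_pairs_def by blast
  have "(\<lambda>x. inv_into (carrier M) f (g x)) \<in> mod_iso R N M"
    by (rule mod_iso_comp[OF g(2) mod_iso_inv[OF M f]])
  from pair_operationD(4)[OF P g(1) this M] show "(L, M) \<in> P"
    by (simp only: image_comp_inv_into[OF g(3) mod_isoD(3)[OF f] L])
qed

lemma transport_op_eq:
  assumes P: "pair_operation R P p" and LM: "(L, M) \<in> P" and f: "f \<in> mod_iso R M M'"
  shows "transport_op R P p (f ` L) M' = f ` p L M"
  unfolding transport_op_def
proof (rule the_equality)
  show "\<exists>(K, N)\<in>P. \<exists>g\<in>mod_iso R N M'. f ` L = g ` K \<and> f ` p L M = g ` p K N"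
    using LM f by blast
next
  fix U assume "\<exists>(K, N)\<in>P. \<exists>g\<in>mod_iso R N M'. f ` L = g ` K \<and> U = g ` p K N"
  then obtain K N g where g: "(K, N) \<in> P" "g \<in> mod_iso R N M'" "f ` L = g ` K" "U = g ` p K N"
    by blast
  note M = pair_operationD(1)[OF P LM]
  have L: "L \<subseteq> carrier M" by (rule submodule_subset[OF M pair_operationD(2)[OF P LM]])
  have "(\<lambda>x. inv_into (carrier M) f (g x)) \<in> mod_iso R N M"
    by (rule mod_iso_comp[OF g(2) mod_iso_inv[OF M f]])
  from pair_operationD(5)[OF P g(1) this M]
  have p: "(\<lambda>x. inv_into (carrier M) f (g x)) ` p K N = p L M"
    by (simp only: image_comp_inv_into[OF g(3) mod_isoD(3)[OF f] L])
  have "f (inv_into (carrier M) f (g x)) = g x" if "x \<in> p K N" for x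
  proof (rule f_inv_into_f)
    have "x \<in> carrier N"
      using submodule_subset[OF pair_operationD(1,3)[OF P g(1)]] that by (rule subsetD)
    then show "g x \<in> f ` carrier M"
      unfolding mod_isoD(4)[OF f] by (rule mod_homD(1)[OF mod_isoD(1)[OF g(2)]])
  qed
  then show "U = f ` p L M"
    unfolding p[symmetric] g(4) image_image by (intro image_cong) simp_all
qed

text \<open>Duality between \<open>(P, p)\<close> and \<open>(Q, q)\<close> in terms of annihilators. The last two clauses range over
  all perfect pairings of \<open>B\<close>, not only the one with \<open>B\<^sup>\<or>\<close>; this is what makes the relation symmetric,
  even though it is stated from the side of \<open>Q\<close>.\<close>

definition dual_operations ::
  "('r, 'x) ring_scheme \<Rightarrow> ('r, 'e) module \<Rightarrow>
   ('a set \<times> ('r, 'a) module) set \<Rightarrow> ('a set \<Rightarrow> ('r, 'a) module \<Rightarrow> 'a set) \<Rightarrow>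
   ('b set \<times> ('r, 'b) module) set \<Rightarrow> ('b set \<Rightarrow> ('r, 'b) module \<Rightarrow> 'b set) \<Rightarrow> bool"
  where "dual_operations R E P p Q q \<longleftrightarrow>
    pair_operation R P p \<and> pair_operation R Q q \<and>
    (\<forall>(L, M)\<in>P. \<exists>(N :: ('r, 'b) module) \<beta>. perfect_pairing R E M N \<beta>) \<and>
    (\<forall>(A, B)\<in>Q. \<exists>(N :: ('r, 'a) module) \<beta>. perfect_pairing R E B N \<beta>) \<and>
    (\<forall>B N \<beta> A. perfect_pairing R E B N \<beta> \<and> submodule A R B \<longrightarrow>
       ((A, B) \<in> Q \<longleftrightarrow> (perp E \<beta> N A, N) \<in> P)) \<and>
    (\<forall>B N \<beta> A. perfect_pairing R E B N \<beta> \<and> (A, B) \<in> Q \<longrightarrow>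
       q A B = perp E (flip \<beta>) B (p (perp E \<beta> N A) N))"

lemma dual_operationsD:
  fixes P :: "('a set \<times> ('r, 'a) module) set" and Q :: "('b set \<times> ('r, 'b) module) set"
  assumes "dual_operations R E P p Q q"
  shows "pair_operation R P p" and "pair_operation R Q q"
    and "(L, M) \<in> P \<Longrightarrow> \<exists>(N :: ('r, 'b) module) \<beta>. perfect_pairing R E M N \<beta>"
    and "(A, B) \<in> Q \<Longrightarrow> \<exists>(N :: ('r, 'a) module) \<beta>. perfect_pairing R E B N \<beta>"
    and "perfect_pairing R E B N \<beta> \<Longrightarrow> submodule A R B \<Longrightarrow>
      (A, B) \<in> Q \<longleftrightarrow> (perp E \<beta> N A, N) \<in> P"
    and "perfect_pairing R E B N \<beta> \<Longrightarrow> (A, B) \<in> Q \<Longrightarrow>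
      q A B = perp E (flip \<beta>) B (p (perp E \<beta> N A) N)"
  using assms unfolding dual_operations_def by blast+

context matlis_duality begin

text \<open>Apply the defining clauses to the annihilator of \<open>L\<close> and use that taking annihilators is an
  involution.\<close>

lemma dual_operations_sym:
  assumes d: "dual_operations R E P p Q q"
  shows "dual_operations R E Q q P p"
  unfolding dual_operations_def
proof (intro conjI allI impI, goal_cases)
  case 3
  show ?case using dual_operationsD(4)[OF d] by blast
next
  case 4
  show ?case using dual_operationsD(3)[OF d] by blast
next
  case (5 M N \<beta> L)
  then have \<beta>: "perfect_pairing R E M N \<beta>" and L: "submodule L R M" by simp_all
  have N: "submodule (perp E \<beta> N L) R N"
    by (rule perp_submodule[OF \<beta> submodule_subset[OF perfect_pairingD(1)[OF \<beta>] L]])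
  show ?case
    using dual_operationsD(5)[OF d perfect_pairing_flip[OF \<beta>] N] by (simp only: perp_perp[OF \<beta> L])
next
  case (6 M N \<beta> L)
  then have \<beta>: "perfect_pairing R E M N \<beta>" and LM: "(L, M) \<in> P" by simp_all
  note P = pair_operationD[OF dual_operationsD(1)[OF d] LM]
  have N: "submodule (perp E \<beta> N L) R N"
    by (rule perp_submodule[OF \<beta> submodule_subset[OF P(1,2)]])
  have "(perp E \<beta> N L, N) \<in> Q"
    using dual_operationsD(5)[OF d perfect_pairing_flip[OF \<beta>] N] LM
    by (simp only: perp_perp[OF \<beta> P(2)])
  from dual_operationsD(6)[OF d perfect_pairing_flip[OF \<beta>] this]
  have "q (perp E \<beta> N L) N = perp E \<beta> N (p L M)" by (simp only: perp_perp[OF \<beta> P(2)])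
  then show ?case by (simp only: perp_perp[OF \<beta> P(3)])
qed (rule dual_operationsD(1,2)[OF d])+

lemma dual_operations_mem:
  assumes d: "dual_operations R E P p Q q" and \<beta>: "perfect_pairing R E B N \<beta>"
    and AB: "(A, B) \<in> Q"
  shows "(perp E \<beta> N A, N) \<in> P"
  using dual_operationsD(5)[OF d \<beta> pair_operationD(2)[OF dual_operationsD(2)[OF d] AB]] AB by simp

text \<open>By symmetry \<open>p L M\<close> can be read off from \<open>q\<close> through any perfect partner of \<open>M\<close>. Applied in
  both directions, this says that an operation is determined by its dual.\<close>

lemma dual_operations_subset:
  fixes Q :: "('b set \<times> ('r, 'b) module) set"
  assumes d: "dual_operations R E P p Q q" and d': "dual_operations R E P' p' Q q"
    and LM: "(L, M) \<in> P"
  shows "(L, M) \<in> P'" and "p L M = p' L M"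
proof -
  note s = dual_operations_sym[OF d] and s' = dual_operations_sym[OF d']
  obtain N \<beta> where \<beta>: "perfect_pairing R E M (N :: ('r, 'b) module) \<beta>"
    using dual_operationsD(3)[OF d LM] by (elim exE)
  have "(perp E \<beta> N L, N) \<in> Q" by (rule dual_operations_mem[OF s \<beta> LM])
  then show LM': "(L, M) \<in> P'"
    using dual_operationsD(5)[OF s' \<beta> pair_operationD(2)[OF dual_operationsD(1)[OF d] LM]] by simp
  show "p L M = p' L M"
    using dual_operationsD(6)[OF s \<beta> LM] dual_operationsD(6)[OF s' \<beta> LM'] by simp
qed

end

context matlis_duality begin

lemma Collect_image_left_inverse:
  assumes "\<And>x. x \<in> A \<Longrightarrow> g (f x) = x"
  shows "{z \<in> f ` A. Q (g z)} = f ` {x \<in> A. Q x}"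
  using assms by auto

text \<open>What has to be shown is that every functional on \<open>M\<close> comes from an element of \<open>B\<close>. The elements of
  \<open>B\<close> form a submodule of \<open>M\<^sup>\<or>\<close> whose annihilator in \<open>M\<close> is zero, since an element of \<open>M\<close> is a
  functional on \<open>B\<close>. As \<open>M\<close> is dualizable, \<open>M\<close> and \<open>M\<^sup>\<or>\<close> are perfectly paired, so this submodule is
  its own double annihilator, which is all of \<open>M\<^sup>\<or>\<close>. In particular the modules of a dual collection
  are again dualizable.\<close>

lemma pairing_of_iso_to_dual:
  assumes M: "module R M" and refl: "matlis_dualizable R E M" and B: "module R B"
    and f: "f \<in> mod_iso R M (dual R E B)"
  shows "perfect_pairing R E B M (\<lambda>b m. f m b)"
proof -
  interpret M: module R M by (rule M)
  interpret B: module R B by (rule B)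
  let ?D = "dual R E M"
  let ?\<delta> = "\<lambda>b. \<lambda>m\<in>carrier M. f m b"
  note fh = mod_isoD(1)[OF f]
  have fm: "f m \<in> mod_hom R B E" if "m \<in> carrier M" for m
    using mod_homD(1)[OF fh that] by simp
  have fb: "(\<lambda>m. f m b) \<in> mod_hom R M E" if b: "b \<in> carrier B" for b
  proof (rule mod_homI)
    show "f m b \<in> carrier E" if "m \<in> carrier M" for m by (rule mod_homD(1)[OF fm[OF that] b])
    show "f (m \<oplus>\<^bsub>M\<^esub> n) b = f m b \<oplus>\<^bsub>E\<^esub> f n b" if "m \<in> carrier M" "n \<in> carrier M" for m n
      using mod_homD(2)[OF fh that] b by simp
    show "f (r \<odot>\<^bsub>M\<^esub> m) b = r \<odot>\<^bsub>E\<^esub> f m b" if "r \<in> carrier R" "m \<in> carrier M" for r m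
      using mod_homD(3)[OF fh that] b by simp
  qed
  have D: "module R ?D" by (rule module_dual[OF M module_E])
  have DB: "module R (dual R E B)" by (rule module_dual[OF B module_E])
  have \<gamma>: "perfect_pairing R E M ?D (\<lambda>x g. g x)" by (rule perfect_pairing_dual[OF M refl])
  have \<delta>: "?\<delta> \<in> mod_hom R B ?D"
  proof (rule mod_homI)
    show "?\<delta> b \<in> carrier ?D" if "b \<in> carrier B" for b by (rule restrict_in_dual[OF M fb[OF that]])
    show "?\<delta> (b \<oplus>\<^bsub>B\<^esub> c) = ?\<delta> b \<oplus>\<^bsub>?D\<^esub> ?\<delta> c" if "b \<in> carrier B" "c \<in> carrier B" for b c
      unfolding dual_simps using that by (intro restrict_ext) (simp add: mod_homD(2)[OF fm])
    show "?\<delta> (r \<odot>\<^bsub>B\<^esub> b) = r \<odot>\<^bsub>?D\<^esub> ?\<delta> b" if "r \<in> carrier R" "b \<in> carrier B" for r b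
      unfolding dual_simps using that by (intro restrict_ext) (simp add: mod_homD(3)[OF fm])
  qed
  have sub: "submodule (?\<delta> ` carrier B) R ?D"
    by (rule submodule_image[OF B D \<delta> B.carrier_is_submodule])
  have "perp E (\<lambda>g x. g x) M (?\<delta> ` carrier B) = {\<zero>\<^bsub>M\<^esub>}"
  proof
    show "perp E (\<lambda>g x. g x) M (?\<delta> ` carrier B) \<subseteq> {\<zero>\<^bsub>M\<^esub>}"
    proof
      fix m assume "m \<in> perp E (\<lambda>g x. g x) M (?\<delta> ` carrier B)"
      then have m: "m \<in> carrier M" and z: "\<And>b. b \<in> carrier B \<Longrightarrow> f m b = \<zero>\<^bsub>E\<^esub>"
        by (auto simp: perp_def)
      have "f \<zero>\<^bsub>M\<^esub> = \<zero>\<^bsub>dual R E B\<^esub>" by (rule mod_hom_zero[OF M DB fh])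
      moreover have "f m = (\<lambda>b\<in>carrier B. \<zero>\<^bsub>E\<^esub>)"
        by (rule extensionalityI[of "f m" "carrier B"])
          (use mod_homD(1)[OF fh m] z in simp_all)
      ultimately have "f m = f \<zero>\<^bsub>M\<^esub>" by simp
      then show "m \<in> {\<zero>\<^bsub>M\<^esub>}" using inj_onD[OF mod_isoD(3)[OF f] _ m M.zero_closed] by simp
    qed
    show "{\<zero>\<^bsub>M\<^esub>} \<subseteq> perp E (\<lambda>g x. g x) M (?\<delta> ` carrier B)"
      using mod_hom_zero[OF M module_E fb] by (auto simp: perp_def)
  qed
  from perp_perp[OF perfect_pairing_flip[OF \<gamma>] sub, unfolded this]
  have onto: "?\<delta> ` carrier B = carrier ?D" by (simp only: perp_zero[OF \<gamma>])
  show ?thesis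
    unfolding perfect_pairing_def
  proof (intro conjI ballI)
    fix u assume "u \<in> mod_hom R M E"
    then have "restrict u (carrier M) \<in> ?\<delta> ` carrier B"
      unfolding onto by (rule restrict_in_dual[OF M])
    then obtain b where b: "b \<in> carrier B" "restrict u (carrier M) = ?\<delta> b" by (elim imageE)
    have "f m b = u m" if "m \<in> carrier M" for m using fun_cong[OF b(2), of m] that by simp
    then show "\<exists>b\<in>carrier B. \<forall>m\<in>carrier M. f m b = u m" using b(1) by (intro bexI[of _ b] ballI)
  next
    fix u assume "u \<in> mod_hom R B E"
    then have "restrict u (carrier B) \<in> f ` carrier M"
      unfolding mod_isoD(4)[OF f] by (rule restrict_in_dual[OF B])
    then obtain m where m: "m \<in> carrier M" "restrict u (carrier B) = f m" by (elim imageE)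
    have "f m b = u b" if "b \<in> carrier B" for b using fun_cong[OF m(2), of b] that by simp
    then show "\<exists>m\<in>carrier M. \<forall>b\<in>carrier B. f m b = u b" using m(1) by (intro bexI[of _ m] ballI)
  qed (rule B M fm fb, assumption?)+
qed

text \<open>The pairing gives an isomorphism from \<open>N\<close> to \<open>B\<^sup>\<or>\<close> that carries the annihilator of \<open>A\<close> to
  \<open>(B/A)\<^sup>\<or>\<close>.\<close>

lemma dual_pairs_iff:
  assumes P: "pair_operation R P p" and \<beta>: "perfect_pairing R E B N \<beta>" and A: "submodule A R B"
  shows "(A, B) \<in> dual_pairs R E P \<longleftrightarrow> (perp E \<beta> N A, N) \<in> P"
proof -
  have B: "module R B" by (rule perfect_pairingD(1)[OF \<beta>])
  have "(quot_dual R E A B, dual R E B) \<in> transport_pairs R P \<longleftrightarrow> (perp E \<beta> N A, N) \<in> P"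
    using transport_pairs_iff[OF P perfect_pairingD(2)[OF \<beta>] perp_carrier
        pairing_iso_dual[OF \<beta>] module_dual[OF B module_E], of E \<beta> A]
    by (simp only: pairing_iso_dual_perp[OF \<beta> A])
  then show ?thesis using A B by (simp add: dual_pairs_def)
qed

text \<open>Under the same isomorphism, the condition that evaluation at \<open>b\<close> vanishes on the transported
  value of \<open>p\<close> says that \<open>b\<close> is orthogonal to the value of \<open>p\<close> in \<open>N\<close>.\<close>

lemma dual_op_eq:
  assumes P: "pair_operation R P p" and \<beta>: "perfect_pairing R E B N \<beta>" and A: "submodule A R B"
    and AP: "(perp E \<beta> N A, N) \<in> P"
  shows "dual_op R E P p A B = perp E (flip \<beta>) B (p (perp E \<beta> N A) N)"
proof -
  let ?D = "dual R E B"
  let ?\<tau> = "\<lambda>y. \<lambda>x\<in>carrier B. \<beta> x y"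
  let ?U = "p (perp E \<beta> N A) N"
  have B: "module R B" and N: "module R N" by (rule perfect_pairingD[OF \<beta>])+
  have D: "module R ?D" by (rule module_dual[OF B module_E])
  note iso = pairing_iso_dual[OF \<beta>]
  have U: "submodule ?U R N" by (rule pair_operationD(3)[OF P AP])
  have \<tau>U: "submodule (?\<tau> ` ?U) R ?D" by (rule submodule_image[OF N D mod_isoD(1)[OF iso] U])
  have "transport_op R P p (quot_dual R E A B) ?D = ?\<tau> ` ?U"
    using transport_op_eq[OF P AP iso] by (simp only: pairing_iso_dual_perp[OF \<beta> A])
  then have eq: "dual_op R E P p A B = {b \<in> carrier B. eval_map R E B b \<in>
      {F \<in> carrier (dual R E ?D). \<forall>f\<in>?\<tau> ` ?U. F f = \<zero>\<^bsub>E\<^esub>}}"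
    by (simp only: dual_op_def quot_dual_eq[OF D module_E \<tau>U])
  have "eval_map R E B \<in> mod_iso R B (dual R E ?D)"
    using dualizable_if_perfect_pairing[OF \<beta>] by (simp only: matlis_dualizable_def)
  note ev = mod_homD(1)[OF mod_isoD(1)[OF this]]
  have val: "eval_map R E B b (?\<tau> u) = \<beta> b u" if "b \<in> carrier B" "u \<in> ?U" for b u
  proof -
    have "?\<tau> u \<in> carrier ?D"
      by (rule mod_homD(1)[OF mod_isoD(1)[OF iso] subsetD[OF submodule_subset[OF N U] that(2)]])
    then show ?thesis using that(1) unfolding eval_map_def by simp
  qed
  have "eval_map R E B b \<in> {F \<in> carrier (dual R E ?D). \<forall>f\<in>?\<tau> ` ?U. F f = \<zero>\<^bsub>E\<^esub>} \<longleftrightarrow>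
      (\<forall>u\<in>?U. \<beta> b u = \<zero>\<^bsub>E\<^esub>)" if b: "b \<in> carrier B" for b
  proof -
    have "(\<forall>f\<in>?\<tau> ` ?U. eval_map R E B b f = \<zero>\<^bsub>E\<^esub>) \<longleftrightarrow> (\<forall>u\<in>?U. eval_map R E B b (?\<tau> u) = \<zero>\<^bsub>E\<^esub>)"
      by (rule ball_simps)
    also have "\<dots> \<longleftrightarrow> (\<forall>u\<in>?U. \<beta> b u = \<zero>\<^bsub>E\<^esub>)"
      by (intro ball_cong refl) (simp only: val[OF b])
    finally show ?thesis using ev[OF b] by (simp only: mem_Collect_eq simp_thms)
  qed
  then show ?thesis unfolding eq perp_def by (rule Collect_cong[OF conj_cong[OF refl]])
qed

theorem dual_operations_dual:
  fixes P :: "('a set \<times> ('r, 'a) module) set"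
  assumes P: "pair_operation R P p"
    and ex: "\<And>L M. (L, M) \<in> P \<Longrightarrow> \<exists>(N :: ('r, 'b) module) \<beta>. perfect_pairing R E M N \<beta>"
  shows "dual_operations R E P p (dual_pairs R E P :: ('b set \<times> ('r, 'b) module) set) (dual_op R E P p)"
proof -
  let ?Q = "dual_pairs R E P :: ('b set \<times> ('r, 'b) module) set"
  let ?q = "dual_op R E P p"
  have QD: "module R B" "submodule A R B" if "(A, B) \<in> ?Q" for A and B :: "('r, 'b) module"
    using that by (simp_all add: dual_pairs_def)
  have exQ: "\<exists>(N :: ('r, 'a) module) \<beta>. perfect_pairing R E B N \<beta>" if AB: "(A, B) \<in> ?Q" for A B
  proof -
    have "(quot_dual R E A B, dual R E B) \<in> transport_pairs R P"
      using AB by (simp add: dual_pairs_def)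
    then obtain L M f where LM: "(L, M) \<in> P" and f: "f \<in> mod_iso R M (dual R E B)"
      unfolding transport_pairs_def by blast
    have refl: "matlis_dualizable R E M"
      using ex[OF LM] by (elim exE) (rule dualizable_if_perfect_pairing)
    show ?thesis
      by (rule exI, rule exI)
        (rule pairing_of_iso_to_dual[OF pair_operationD(1)[OF P LM] refl QD(1)[OF AB] f])
  qed
  have val: "(perp E \<beta> N A, N) \<in> P" "?q A B = perp E (flip \<beta>) B (p (perp E \<beta> N A) N)"
    if \<beta>: "perfect_pairing R E B N \<beta>" and AB: "(A, B) \<in> ?Q" for B N \<beta> A
  proof -
    show AP: "(perp E \<beta> N A, N) \<in> P" using dual_pairs_iff[OF P \<beta> QD(2)[OF AB]] AB by simp
    show "?q A B = perp E (flip \<beta>) B (p (perp E \<beta> N A) N)"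
      by (rule dual_op_eq[OF P \<beta> QD(2)[OF AB] AP])
  qed
  have sub: "submodule (?q A B) R B" if AB: "(A, B) \<in> ?Q" for A and B :: "('r, 'b) module"
  proof -
    obtain N \<beta> where \<beta>: "perfect_pairing R E B (N :: ('r, 'a) module) \<beta>"
      using exQ[OF AB] by (elim exE)
    note U = pair_operationD(3)[OF P val(1)[OF \<beta> AB]]
    show ?thesis
      unfolding val(2)[OF \<beta> AB]
      by (rule perp_submodule[OF perfect_pairing_flip[OF \<beta>]
            submodule_subset[OF perfect_pairingD(2)[OF \<beta>] U]])
  qed
  have iso: "(f ` A, B') \<in> ?Q" "f ` ?q A B = ?q (f ` A) B'"
    if AB: "(A, B) \<in> ?Q" and f: "f \<in> mod_iso R B B'" and B': "module R B'"
    for A f and B B' :: "('r, 'b) module"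
  proof -
    obtain N \<beta> where \<beta>: "perfect_pairing R E B (N :: ('r, 'a) module) \<beta>"
      using exQ[OF AB] by (elim exE)
    let ?\<beta>' = "\<lambda>x. \<beta> (inv_into (carrier B) f x)"
    have \<beta>': "perfect_pairing R E B' N ?\<beta>'" by (rule perfect_pairing_iso[OF \<beta> B' f])
    have Asub: "A \<subseteq> carrier B" by (rule submodule_subset[OF QD[OF AB]])
    have fA: "submodule (f ` A) R B'"
      by (rule submodule_image[OF QD(1)[OF AB] B' mod_isoD(1)[OF f] QD(2)[OF AB]])
    have inv: "inv_into (carrier B) f (f x) = x" if "x \<in> carrier B" for x
      by (rule inv_into_f_f[OF mod_isoD(3)[OF f] that])
    have perp: "perp E ?\<beta>' N (f ` A) = perp E \<beta> N A"
      using inv[OF subsetD[OF Asub]] by (simp add: perp_def)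
    show Q: "(f ` A, B') \<in> ?Q"
      using dual_pairs_iff[OF P \<beta>' fA] val(1)[OF \<beta> AB] by (simp only: perp)
    let ?U = "p (perp E \<beta> N A) N"
    have "?q (f ` A) B' = {x \<in> f ` carrier B. \<forall>y\<in>?U. ?\<beta>' x y = \<zero>\<^bsub>E\<^esub>}"
      unfolding val(2)[OF \<beta>' Q] perp mod_isoD(4)[OF f] by (simp only: perp_def)
    also have "\<dots> = f ` {x \<in> carrier B. \<forall>y\<in>?U. \<beta> x y = \<zero>\<^bsub>E\<^esub>}"
      by (rule Collect_image_left_inverse[of "carrier B" "inv_into (carrier B) f" f
            "\<lambda>x. \<forall>y\<in>?U. \<beta> x y = \<zero>\<^bsub>E\<^esub>"]) (rule inv)
    also have "\<dots> = f ` ?q A B"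
      unfolding val(2)[OF \<beta> AB] by (simp only: perp_def)
    finally show "f ` ?q A B = ?q (f ` A) B'" by (rule sym)
  qed
  have "pair_operation R ?Q ?q"
    unfolding pair_operation_def pair_class_def
  proof (intro conjI ballI allI impI; clarify)
    fix A and B :: "('r, 'b) module" assume AB: "(A, B) \<in> ?Q"
    show "module R B \<and> submodule A R B" using QD[OF AB] by (rule conjI)
    show "submodule (?q A B) R B" by (rule sub[OF AB])
    fix B' :: "('r, 'b) module" and f assume f: "f \<in> mod_iso R B B'" "module R B'"
    show "(f ` A, B') \<in> ?Q" "f ` ?q A B = ?q (f ` A) B'" by (rule iso[OF AB f])+
  qed
  then show ?thesis
    unfolding dual_operations_def
  proof (intro conjI allI impI)
    show "\<forall>(L, M)\<in>P. \<exists>(N :: ('r, 'b) module) \<beta>. perfect_pairing R E M N \<beta>"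
      by clarify (rule ex)
    show "\<forall>(A, B)\<in>?Q. \<exists>(N :: ('r, 'a) module) \<beta>. perfect_pairing R E B N \<beta>"
      by clarify (rule exQ)
    fix B :: "('r, 'b) module" and N :: "('r, 'a) module" and \<beta> A
    show "(A, B) \<in> ?Q \<longleftrightarrow> (perp E \<beta> N A, N) \<in> P"
      if "perfect_pairing R E B N \<beta> \<and> submodule A R B"
      using that by (elim conjE) (rule dual_pairs_iff[OF P])
    show "?q A B = perp E (flip \<beta>) B (p (perp E \<beta> N A) N)"
      if "perfect_pairing R E B N \<beta> \<and> (A, B) \<in> ?Q"
      using that by (elim conjE) (rule val(2))
  qed (rule P)
qed

end

section \<open>Properties exchanged by duality\<close>

lemma extensiveD: "extensive P p \<Longrightarrow> (L, M) \<in> P \<Longrightarrow> L \<subseteq> p L M"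
  unfolding extensive_def by fast

lemma intensiveD: "intensive P p \<Longrightarrow> (L, M) \<in> P \<Longrightarrow> p L M \<subseteq> L"
  unfolding intensive_def by fast

lemma order_preservingD:
  "order_preserving P p \<Longrightarrow> (L, M) \<in> P \<Longrightarrow> (N, M) \<in> P \<Longrightarrow> L \<subseteq> N \<Longrightarrow> p L M \<subseteq> p N M"
  unfolding order_preserving_def by metis

lemma idempotent_opD:
  "idempotent_op P p \<Longrightarrow> (L, M) \<in> P \<Longrightarrow> (p L M, M) \<in> P \<Longrightarrow> p (p L M) M = p L M"
  unfolding idempotent_op_def by metis

lemma functorialD:
  "functorial R P p \<Longrightarrow> g \<in> mod_hom R M M' \<Longrightarrow> (L, M) \<in> P \<Longrightarrow> (g ` L, M') \<in> P \<Longrightarrow>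
    g ` p L M \<subseteq> p (g ` L) M'"
  unfolding functorial_def by metis

lemma surjection_functorialD:
  "surjection_functorial R P p \<Longrightarrow> g \<in> mod_hom R M M' \<Longrightarrow> g ` carrier M = carrier M' \<Longrightarrow>
    (L, M) \<in> P \<Longrightarrow> (g ` L, M') \<in> P \<Longrightarrow> g ` p L M \<subseteq> p (g ` L) M'"
  unfolding surjection_functorial_def by metis

lemma restrictableD:
  "restrictable R P p \<Longrightarrow> submodule N R M \<Longrightarrow> (L \<inter> N, M\<lparr>carrier := N\<rparr>) \<in> P \<Longrightarrow> (L, M) \<in> P \<Longrightarrow>
    p (L \<inter> N) (M\<lparr>carrier := N\<rparr>) \<subseteq> p L M"
  unfolding restrictable_def by metis

context matlis_duality begin

lemma dual_intensive:
  fixes P :: "('a set \<times> ('r, 'a) module) set"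
  assumes d: "dual_operations R E P p Q q" and p: "extensive P p"
  shows "intensive Q q"
  unfolding intensive_def
proof clarify
  fix A B x assume AB: "(A, B) \<in> Q" and x: "x \<in> q A B"
  obtain N \<beta> where \<beta>: "perfect_pairing R E B (N :: ('r, 'a) module) \<beta>"
    using dual_operationsD(4)[OF d AB] by (elim exE)
  have "perp E \<beta> N A \<subseteq> p (perp E \<beta> N A) N"
    by (rule extensiveD[OF p dual_operations_mem[OF d \<beta> AB]])
  then have "q A B \<subseteq> perp E (flip \<beta>) B (perp E \<beta> N A)"
    unfolding dual_operationsD(6)[OF d \<beta> AB] by (rule perp_antimono)
  also have "\<dots> = A"
    by (rule perp_perp[OF \<beta> pair_operationD(2)[OF dual_operationsD(2)[OF d] AB]])
  finally show "x \<in> A" using x by (rule subsetD)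
qed

lemma dual_extensive:
  fixes P :: "('a set \<times> ('r, 'a) module) set"
  assumes d: "dual_operations R E P p Q q" and p: "intensive P p"
  shows "extensive Q q"
  unfolding extensive_def
proof clarify
  fix A B x assume AB: "(A, B) \<in> Q" and x: "x \<in> A"
  obtain N \<beta> where \<beta>: "perfect_pairing R E B (N :: ('r, 'a) module) \<beta>"
    using dual_operationsD(4)[OF d AB] by (elim exE)
  have "p (perp E \<beta> N A) N \<subseteq> perp E \<beta> N A"
    by (rule intensiveD[OF p dual_operations_mem[OF d \<beta> AB]])
  then have "perp E (flip \<beta>) B (perp E \<beta> N A) \<subseteq> q A B"
    unfolding dual_operationsD(6)[OF d \<beta> AB] by (rule perp_antimono)
  also have "perp E (flip \<beta>) B (perp E \<beta> N A) = A"
    by (rule perp_perp[OF \<beta> pair_operationD(2)[OF dual_operationsD(2)[OF d] AB]])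
  finally show "x \<in> q A B" using x by (rule subsetD)
qed

lemma dual_order_preserving:
  fixes P :: "('a set \<times> ('r, 'a) module) set"
  assumes d: "dual_operations R E P p Q q" and p: "order_preserving P p"
  shows "order_preserving Q q"
  unfolding order_preserving_def
proof (intro allI impI, elim conjE)
  fix A A' B assume AB: "(A, B) \<in> Q" and A'B: "(A', B) \<in> Q" and sub: "A \<subseteq> A'"
  obtain N \<beta> where \<beta>: "perfect_pairing R E B (N :: ('r, 'a) module) \<beta>"
    using dual_operationsD(4)[OF d AB] by (elim exE)
  have "p (perp E \<beta> N A') N \<subseteq> p (perp E \<beta> N A) N"
    by (rule order_preservingD[OF p dual_operations_mem[OF d \<beta> A'B]
          dual_operations_mem[OF d \<beta> AB] perp_antimono[OF sub]])
  then show "q A B \<subseteq> q A' B"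
    unfolding dual_operationsD(6)[OF d \<beta> AB] dual_operationsD(6)[OF d \<beta> A'B]
    by (rule perp_antimono)
qed

lemma dual_idempotent:
  fixes P :: "('a set \<times> ('r, 'a) module) set"
  assumes d: "dual_operations R E P p Q q" and p: "idempotent_op P p"
  shows "idempotent_op Q q"
  unfolding idempotent_op_def
proof (intro allI impI, elim conjE)
  fix A B assume AB: "(A, B) \<in> Q" and qAB: "(q A B, B) \<in> Q"
  obtain N \<beta> where \<beta>: "perfect_pairing R E B (N :: ('r, 'a) module) \<beta>"
    using dual_operationsD(4)[OF d AB] by (elim exE)
  let ?V = "perp E \<beta> N A"
  have V: "(?V, N) \<in> P" by (rule dual_operations_mem[OF d \<beta> AB])
  have perp: "perp E \<beta> N (q A B) = p ?V N"
    using perp_perp[OF perfect_pairing_flip[OF \<beta>] pair_operationD(3)[OF dual_operationsD(1)[OF d] V]]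
    by (simp only: dual_operationsD(6)[OF d \<beta> AB])
  have "(p ?V N, N) \<in> P" using dual_operations_mem[OF d \<beta> qAB] by (simp only: perp)
  then have idem: "p (p ?V N) N = p ?V N" by (rule idempotent_opD[OF p V])
  have "q (q A B) B = perp E (flip \<beta>) B (p ?V N)"
    unfolding dual_operationsD(6)[OF d \<beta> qAB] perp idem ..
  also have "\<dots> = q A B" by (rule dual_operationsD(6)[OF d \<beta> AB, symmetric])
  finally show "q (q A B) B = q A B" .
qed

text \<open>An inclusion for values of \<open>p\<close> along the adjoint \<open>h\<close> dualizes to the inclusion for values of \<open>q\<close>
  along \<open>g\<close>. Functoriality, surjection-functoriality and restrictability are all dualized in this
  way.\<close>

lemma image_perp_subset:
  assumes adj: "adjoint M N' \<beta> \<beta>' g h" and g: "g \<in> mod_hom R M M'"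
    and U: "U' \<subseteq> carrier N'" "h ` U' \<subseteq> U"
  shows "g ` perp E (flip \<beta>) M U \<subseteq> perp E (flip \<beta>') M' U'"
proof (rule image_subsetI)
  fix x assume "x \<in> perp E (flip \<beta>) M U"
  then have x: "x \<in> carrier M" and z: "\<And>y. y \<in> U \<Longrightarrow> \<beta> x y = \<zero>\<^bsub>E\<^esub>"
    by (simp_all add: perp_def)
  have "\<beta>' (g x) y = \<zero>\<^bsub>E\<^esub>" if y: "y \<in> U'" for y
  proof -
    have "\<beta>' (g x) y = \<beta> x (h y)" using adj x subsetD[OF U(1) y] by (simp add: adjoint_def)
    also have "\<dots> = \<zero>\<^bsub>E\<^esub>" by (rule z[OF subsetD[OF U(2) imageI[OF y]]])
    finally show ?thesis .
  qed
  then show "g x \<in> perp E (flip \<beta>') M' U'"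
    using mod_homD(1)[OF g x] by (simp add: perp_def)
qed

text \<open>By adjointness the preimage of \<open>A'\<close> is the annihilator of \<open>h\<close> applied to the annihilator of \<open>A'\<close>;
  take annihilators once more.\<close>

lemma perp_preimage:
  assumes \<beta>: "perfect_pairing R E M N \<beta>" and \<beta>': "perfect_pairing R E M' N' \<beta>'"
    and g: "g \<in> mod_hom R M M'" and h: "h \<in> mod_hom R N' N" and adj: "adjoint M N' \<beta> \<beta>' g h"
    and A': "submodule A' R M'"
  shows "perp E \<beta> N {x \<in> carrier M. g x \<in> A'} = h ` perp E \<beta>' N' A'"
proof -
  let ?W = "perp E \<beta>' N' A'"
  have W: "submodule ?W R N'"
    by (rule perp_submodule[OF \<beta>' submodule_subset[OF perfect_pairingD(1)[OF \<beta>'] A']])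
  have hW: "submodule (h ` ?W) R N"
    by (rule submodule_image[OF perfect_pairingD(2)[OF \<beta>'] perfect_pairingD(2)[OF \<beta>] h W])
  have "perp E (flip \<beta>) M (h ` ?W) = {x \<in> carrier M. g x \<in> A'}"
    using perp_image[OF adjoint_flip[OF adj] mod_hom_funcset[OF g] perp_carrier, of E E \<beta>' A']
    by (simp only: perp_perp[OF \<beta>' A'])
  with perp_perp[OF perfect_pairing_flip[OF \<beta>] hW] show ?thesis by simp
qed

lemma submodule_preimage:
  assumes M: "module R M" and M': "module R M'" and g: "g \<in> mod_hom R M M'" and A': "submodule A' R M'"
  shows "submodule {x \<in> carrier M. g x \<in> A'} R M"
proof -
  interpret M: module R M by (rule M)
  show ?thesis
    unfolding submodule_iff[OF M]
    using A'[unfolded submodule_iff[OF M']] mod_hom_zero[OF M M' g]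
    by (simp add: mod_homD[OF g])
qed

text \<open>The adjoint \<open>h\<close> of a surjection is injective, hence an isomorphism from \<open>N'\<close> onto a submodule \<open>K\<close>
  of \<open>N\<close>. It carries the annihilator of \<open>g(A)\<close> to the intersection of \<open>K\<close> with the annihilator of
  \<open>A\<close>, which is the situation that restrictability speaks about.\<close>

lemma dual_surjection_functorial:
  fixes P :: "('a set \<times> ('r, 'a) module) set"
  assumes d: "dual_operations R E P p Q q" and p: "restrictable R P p"
  shows "surjection_functorial R Q q"
  unfolding surjection_functorial_def
proof (intro allI ballI impI, elim conjE)
  fix A B B' g assume g: "g \<in> mod_hom R B B'" and onto: "g ` carrier B = carrier B'"
    and AB: "(A, B) \<in> Q" and gAB': "(g ` A, B') \<in> Q"
  note P = dual_operationsD(1)[OF d]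
  obtain N \<beta> where \<beta>: "perfect_pairing R E B (N :: ('r, 'a) module) \<beta>"
    using dual_operationsD(4)[OF d AB] by (elim exE)
  obtain N' \<beta>' where \<beta>': "perfect_pairing R E B' (N' :: ('r, 'a) module) \<beta>'"
    using dual_operationsD(4)[OF d gAB'] by (elim exE)
  obtain h where h: "h \<in> mod_hom R N' N" and adj: "adjoint B N' \<beta> \<beta>' g h"
    using adjoint_exists[OF \<beta> \<beta>' g] .
  let ?V = "perp E \<beta> N A" and ?W = "perp E \<beta>' N' (g ` A)" and ?K = "h ` carrier N'"
  have N: "module R N" and N': "module R N'"
    by (rule perfect_pairingD(2)[OF \<beta>] perfect_pairingD(2)[OF \<beta>'])+
  interpret N': module R N' by (rule N')
  have V: "(?V, N) \<in> P" and W: "(?W, N') \<in> P"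
    by (rule dual_operations_mem[OF d \<beta> AB] dual_operations_mem[OF d \<beta>' gAB'])+
  have Asub: "A \<subseteq> carrier B"
    by (rule submodule_subset[OF pair_operationD(1,2)[OF dual_operationsD(2)[OF d] AB]])
  have K: "submodule ?K R N" by (rule submodule_image[OF N' N h N'.carrier_is_submodule])
  have mK: "module R (N\<lparr>carrier := ?K\<rparr>)" by (rule submodule.submodule_is_module[OF K N])
  have "inj_on h (carrier N')"
  proof (rule inj_onI)
    fix y z assume yz: "y \<in> carrier N'" "z \<in> carrier N'" and eq: "h y = h z"
    show "y = z"
    proof (rule pairing_eqI[OF \<beta>' yz])
      fix x' assume "x' \<in> carrier B'"
      then obtain x where x: "x \<in> carrier B" "x' = g x" using onto by blast
      have "\<beta>' (g x) y = \<beta> x (h y)" "\<beta>' (g x) z = \<beta> x (h z)"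
        using adj x(1) yz by (simp_all add: adjoint_def)
      then show "\<beta>' x' y = \<beta>' x' z" using eq x(2) by simp
    qed
  qed
  moreover have "h \<in> mod_hom R N' (N\<lparr>carrier := ?K\<rparr>)"
    by (rule mod_homI) (simp_all add: mod_homD[OF h])
  ultimately have iso: "h \<in> mod_iso R N' (N\<lparr>carrier := ?K\<rparr>)"
    by (simp add: mod_iso_def bij_betw_def)
  have hW: "h ` ?W = ?V \<inter> ?K"
    unfolding perp_image[OF adj mod_hom_funcset[OF h] Asub] by blast
  have VK: "(?V \<inter> ?K, N\<lparr>carrier := ?K\<rparr>) \<in> P" and hpW: "h ` p ?W N' = p (?V \<inter> ?K) (N\<lparr>carrier := ?K\<rparr>)"
    using pair_operationD(4,5)[OF P W iso mK] by (simp_all only: hW)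
  have "h ` p ?W N' \<subseteq> p ?V N"
    unfolding hpW by (rule restrictableD[OF p K VK V])
  then show "g ` q A B \<subseteq> q (g ` A) B'"
    unfolding dual_operationsD(6)[OF d \<beta> AB] dual_operationsD(6)[OF d \<beta>' gAB']
    by (rule image_perp_subset[OF adj g submodule_subset[OF pair_operationD(1,3)[OF P W]]])
qed

text \<open>The adjoint \<open>h\<close> of the inclusion of \<open>K\<close> is restriction of functionals. It maps the annihilator
  of a submodule \<open>C\<close> onto that of \<open>C \<inter> K\<close>, and the case \<open>C = 0\<close> shows that it is surjective.\<close>

lemma dual_restrictable:
  fixes P :: "('a set \<times> ('r, 'a) module) set"
  assumes d: "dual_operations R E P p Q q" and p: "surjection_functorial R P p"
  shows "restrictable R Q q"
  unfolding restrictable_def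
proof (intro allI impI, elim conjE)
  fix A K B assume K: "submodule K R B" and AB: "(A, B) \<in> Q"
    and AK: "(A \<inter> K, B\<lparr>carrier := K\<rparr>) \<in> Q"
  let ?K = "B\<lparr>carrier := K\<rparr>"
  note P = dual_operationsD(1)[OF d]
  obtain N \<beta> where \<beta>: "perfect_pairing R E B (N :: ('r, 'a) module) \<beta>"
    using dual_operationsD(4)[OF d AB] by (elim exE)
  obtain N' \<beta>' where \<beta>': "perfect_pairing R E ?K (N' :: ('r, 'a) module) \<beta>'"
    using dual_operationsD(4)[OF d AK] by (elim exE)
  have B: "module R B" and A: "submodule A R B"
    by (rule pair_operationD[OF dual_operationsD(2)[OF d] AB])+
  interpret B: module R B by (rule B)
  have Ksub: "K \<subseteq> carrier B" by (rule submodule_subset[OF B K])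
  have incl: "(\<lambda>x. x) \<in> mod_hom R ?K B"
    by (rule mod_homI) (use Ksub in auto)
  obtain h where h: "h \<in> mod_hom R N N'" and adj: "adjoint ?K N \<beta>' \<beta> (\<lambda>x. x) h"
    using adjoint_exists[OF \<beta>' \<beta> incl] .
  have restr: "h ` perp E \<beta> N C = perp E \<beta>' N' (C \<inter> K)" if C: "submodule C R B" for C
  proof -
    have "{x \<in> carrier ?K. x \<in> C} = C \<inter> K" by auto
    then show ?thesis using perp_preimage[OF \<beta>' \<beta> incl h adj C] by simp
  qed
  let ?V = "perp E \<beta> N A" and ?W = "perp E \<beta>' N' (A \<inter> K)"
  have V: "(?V, N) \<in> P" and W: "(?W, N') \<in> P"
    by (rule dual_operations_mem[OF d \<beta> AB] dual_operations_mem[OF d \<beta>' AK])+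
  have zero: "submodule {\<zero>\<^bsub>B\<^esub>} R B" by (simp add: submodule_iff[OF B])
  have "{\<zero>\<^bsub>B\<^esub>} \<inter> K = {\<zero>\<^bsub>?K\<^esub>}" using K submodule_iff[OF B] by auto
  then have onto: "h ` carrier N = carrier N'"
    using restr[OF zero] by (simp only: perp_zero[OF \<beta>] perp_zero[OF \<beta>'])
  have hV: "h ` ?V = ?W" by (rule restr[OF A])
  have "(h ` ?V, N') \<in> P" using W by (simp only: hV)
  then have "h ` p ?V N \<subseteq> p (h ` ?V) N'"
    by (rule surjection_functorialD[OF p h onto V])
  then have "h ` p ?V N \<subseteq> p ?W N'" by (simp only: hV)
  from image_perp_subset[OF adj incl submodule_subset[OF pair_operationD(1,3)[OF P V]] this]
  show "q (A \<inter> K) ?K \<subseteq> q A B"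
    unfolding dual_operationsD(6)[OF d \<beta> AB] dual_operationsD(6)[OF d \<beta>' AK]
    by (simp only: image_ident)
qed

lemma closed_under_mapsD:
  assumes "closed_under_maps R P" and "g \<in> mod_hom R M M'"
  shows "({x \<in> carrier M. g x \<in> L'}, M) \<in> P \<Longrightarrow> (L', M') \<in> P \<Longrightarrow>
      (g ` {x \<in> carrier M. g x \<in> L'}, M') \<in> P"
    and "(L, M) \<in> P \<Longrightarrow> (g ` L, M') \<in> P \<Longrightarrow> ({x \<in> carrier M. g x \<in> g ` L}, M) \<in> P"
  using assms unfolding closed_under_maps_def by blast+

text \<open>Passing to the adjoint turns images into preimages, so each of the two closure conditions for
  \<open>Q\<close> comes from the other one for \<open>P\<close>.\<close>

lemma dual_closed_under_maps:
  fixes P :: "('a set \<times> ('r, 'a) module) set"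
  assumes d: "dual_operations R E P p Q q" and P: "closed_under_maps R P"
  shows "closed_under_maps R Q"
  unfolding closed_under_maps_def
proof (intro conjI allI ballI impI; elim conjE)
  fix A' B B' g assume g: "g \<in> mod_hom R B B'"
    and AB: "({x \<in> carrier B. g x \<in> A'}, B) \<in> Q" and A'B': "(A', B') \<in> Q"
  obtain N \<beta> where \<beta>: "perfect_pairing R E B (N :: ('r, 'a) module) \<beta>"
    using dual_operationsD(4)[OF d AB] by (elim exE)
  obtain N' \<beta>' where \<beta>': "perfect_pairing R E B' (N' :: ('r, 'a) module) \<beta>'"
    using dual_operationsD(4)[OF d A'B'] by (elim exE)
  obtain h where h: "h \<in> mod_hom R N' N" and adj: "adjoint B N' \<beta> \<beta>' g h"
    using adjoint_exists[OF \<beta> \<beta>' g] .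
  let ?A = "{x \<in> carrier B. g x \<in> A'}"
  let ?W = "perp E \<beta>' N' A'"
  note Q = pair_operationD[OF dual_operationsD(2)[OF d]]
  have perpA: "perp E \<beta> N ?A = h ` ?W"
    by (rule perp_preimage[OF \<beta> \<beta>' g h adj Q(2)[OF A'B']])
  have "(?W, N') \<in> P" by (rule dual_operations_mem[OF d \<beta>' A'B'])
  moreover have "(h ` ?W, N) \<in> P"
    using dual_operations_mem[OF d \<beta> AB] by (simp only: perpA)
  ultimately have "({y \<in> carrier N'. h y \<in> h ` ?W}, N') \<in> P"
    by (rule closed_under_mapsD(2)[OF P h])
  moreover have "perp E \<beta>' N' (g ` ?A) = {y \<in> carrier N'. h y \<in> h ` ?W}"
    using perp_image[OF adj mod_hom_funcset[OF h] submodule_subset[OF Q(1,2)[OF AB]], of E]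
    by (simp only: perpA)
  moreover have "submodule (g ` ?A) R B'"
    by (rule submodule_image[OF Q(1)[OF AB] Q(1)[OF A'B'] g Q(2)[OF AB]])
  ultimately show "(g ` ?A, B') \<in> Q"
    using dual_operationsD(5)[OF d \<beta>'] by simp
next
  fix A B B' g assume g: "g \<in> mod_hom R B B'" and AB: "(A, B) \<in> Q" and gAB': "(g ` A, B') \<in> Q"
  obtain N \<beta> where \<beta>: "perfect_pairing R E B (N :: ('r, 'a) module) \<beta>"
    using dual_operationsD(4)[OF d AB] by (elim exE)
  obtain N' \<beta>' where \<beta>': "perfect_pairing R E B' (N' :: ('r, 'a) module) \<beta>'"
    using dual_operationsD(4)[OF d gAB'] by (elim exE)
  obtain h where h: "h \<in> mod_hom R N' N" and adj: "adjoint B N' \<beta> \<beta>' g h"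
    using adjoint_exists[OF \<beta> \<beta>' g] .
  let ?A = "{x \<in> carrier B. g x \<in> g ` A}"
  let ?V = "perp E \<beta> N A"
  note Q = pair_operationD[OF dual_operationsD(2)[OF d]]
  have W: "perp E \<beta>' N' (g ` A) = {y \<in> carrier N'. h y \<in> ?V}"
    by (rule perp_image[OF adj mod_hom_funcset[OF h] submodule_subset[OF Q(1,2)[OF AB]]])
  have perpA: "perp E \<beta> N ?A = h ` {y \<in> carrier N'. h y \<in> ?V}"
    using perp_preimage[OF \<beta> \<beta>' g h adj Q(2)[OF gAB']] by (simp only: W)
  have "({y \<in> carrier N'. h y \<in> ?V}, N') \<in> P"
    using dual_operations_mem[OF d \<beta>' gAB'] by (simp only: W)
  from closed_under_mapsD(1)[OF P h this dual_operations_mem[OF d \<beta> AB]]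
  have "(perp E \<beta> N ?A, N) \<in> P" by (simp only: perpA)
  moreover have "submodule ?A R B"
    by (rule submodule_preimage[OF Q(1)[OF AB] Q(1)[OF gAB'] g Q(2)[OF gAB']])
  ultimately show "(?A, B) \<in> Q"
    using dual_operationsD(5)[OF d \<beta>] by simp
qed

text \<open>The adjoint \<open>h\<close> maps the annihilator \<open>W\<close> of \<open>g(A)\<close> into the annihilator \<open>V\<close> of \<open>A\<close>, but in
  general not onto it. Functoriality compares the values of \<open>p\<close> at \<open>W\<close> and \<open>h(W)\<close>, where the closure
  condition guarantees that \<open>h(W)\<close> belongs to the collection, and monotonicity passes from \<open>h(W)\<close> to
  \<open>V\<close>.\<close>

lemma dual_functorial:
  fixes P :: "('a set \<times> ('r, 'a) module) set"
  assumes d: "dual_operations R E P p Q q" and mono: "order_preserving P p"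
    and closed: "closed_under_maps R P" and p: "functorial R P p"
  shows "functorial R Q q"
  unfolding functorial_def
proof (intro allI ballI impI, elim conjE)
  fix A B B' g assume g: "g \<in> mod_hom R B B'" and AB: "(A, B) \<in> Q" and gAB': "(g ` A, B') \<in> Q"
  obtain N \<beta> where \<beta>: "perfect_pairing R E B (N :: ('r, 'a) module) \<beta>"
    using dual_operationsD(4)[OF d AB] by (elim exE)
  obtain N' \<beta>' where \<beta>': "perfect_pairing R E B' (N' :: ('r, 'a) module) \<beta>'"
    using dual_operationsD(4)[OF d gAB'] by (elim exE)
  obtain h where h: "h \<in> mod_hom R N' N" and adj: "adjoint B N' \<beta> \<beta>' g h"
    using adjoint_exists[OF \<beta> \<beta>' g] .
  let ?V = "perp E \<beta> N A" and ?W = "perp E \<beta>' N' (g ` A)"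
  note P = dual_operationsD(1)[OF d]
  note Q = pair_operationD[OF dual_operationsD(2)[OF d]]
  have V: "(?V, N) \<in> P" and W: "(?W, N') \<in> P"
    by (rule dual_operations_mem[OF d \<beta> AB] dual_operations_mem[OF d \<beta>' gAB'])+
  have Weq: "?W = {y \<in> carrier N'. h y \<in> ?V}"
    by (rule perp_image[OF adj mod_hom_funcset[OF h] submodule_subset[OF Q(1,2)[OF AB]]])
  have hW: "(h ` ?W, N) \<in> P"
    using closed_under_mapsD(1)[OF closed h _ V] W by (simp only: Weq)
  have "h ` p ?W N' \<subseteq> p (h ` ?W) N"
    by (rule functorialD[OF p h W hW])
  also have "p (h ` ?W) N \<subseteq> p ?V N"
  proof (rule order_preservingD[OF mono hW V])
    show "h ` ?W \<subseteq> ?V" unfolding Weq by (rule image_subsetI) simp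
  qed
  finally have "h ` p ?W N' \<subseteq> p ?V N" .
  then show "g ` q A B \<subseteq> q (g ` A) B'"
    unfolding dual_operationsD(6)[OF d \<beta> AB] dual_operationsD(6)[OF d \<beta>' gAB']
    by (rule image_perp_subset[OF adj g submodule_subset[OF pair_operationD(1,3)[OF P W]]])
qed

end

section \<open>Matlis duality for pair operations\<close>

theorem proposition3p6:
  fixes R :: "('r, 'x) ring_scheme" and \<mm> :: "'r set"
    and E :: "('r, 'e) module"
    and P :: "('u set \<times> ('r, 'u) module) set"
    and p :: "'u set \<Rightarrow> ('r, 'u) module \<Rightarrow> 'u set"
    and Pd :: "(('u \<Rightarrow> 'e) set \<times> ('r, 'u \<Rightarrow> 'e) module) set"
    and pd :: "('u \<Rightarrow> 'e) set \<Rightarrow> ('r, 'u \<Rightarrow> 'e) module \<Rightarrow> ('u \<Rightarrow> 'e) set"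
  assumes "noetherian_ring R" and "local_ring_with R \<mm>" and "adically_complete R \<mm>"
    and "injective_hull R (quot_module (self_module R) \<mm>) E"
    and "pair_operation R P p"
    and "\<forall>(L, M)\<in>P. matlis_dualizable R E (M\<lparr>carrier := L\<rparr>) \<and> matlis_dualizable R E M"
    and "Pd = dual_pairs R E P" and "pd = dual_op R E P p"
  shows "(dual_pairs R E Pd = P \<and> (\<forall>(L, M)\<in>P. dual_op R E Pd pd L M = p L M)) \<and>
    (extensive P p \<longrightarrow> intensive Pd pd) \<and>
    (intensive P p \<longrightarrow> extensive Pd pd) \<and>
    (order_preserving P p \<longleftrightarrow> order_preserving Pd pd) \<and>
    (idempotent_op P p \<longleftrightarrow> idempotent_op Pd pd) \<and>
    (closure_operation R P p \<longrightarrow> interior_operation R Pd pd) \<and>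
    (interior_operation R P p \<longrightarrow> closure_operation R Pd pd) \<and>
    (restrictable R P p \<longleftrightarrow> surjection_functorial R Pd pd) \<and>
    (order_preserving P p \<and> closed_under_maps R P \<longrightarrow>
       (functorial R P p \<longleftrightarrow> functorial R Pd pd))"
proof -
  interpret matlis_duality R \<mm> E
    by (rule matlis_duality.intro[OF assms(1,2,4)])
  have d: "dual_operations R E P p Pd pd"
    unfolding assms(7,8)
  proof (rule dual_operations_dual[OF assms(5)])
    fix L M assume LM: "(L, M) \<in> P"
    have "matlis_dualizable R E M" using assms(6) LM by blast
    from perfect_pairing_dual[OF pair_operationD(1)[OF assms(5) LM] this]
    show "\<exists>(N :: ('r, 'u \<Rightarrow> 'e) module) \<beta>. perfect_pairing R E M N \<beta>" by blast
  qed
  note s = dual_operations_sym[OF d]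
  \<comment> \<open>Both \<open>(P, p)\<close> and the double dual are dual to \<open>(Pd, pd)\<close>, hence they agree.\<close>
  have "dual_operations R E Pd pd (dual_pairs R E Pd :: ('u set \<times> ('r, 'u) module) set) (dual_op R E Pd pd)"
    by (rule dual_operations_dual[OF dual_operationsD(2,4)[OF d]])
  note dd = dual_operations_sym[OF this]
  have 1: "dual_pairs R E Pd = P"
    using dual_operations_subset(1)[OF dd d] dual_operations_subset(1)[OF d dd] by (intro equalityI subrelI)
  have 2: "\<forall>(L, M)\<in>P. dual_op R E Pd pd L M = p L M"
    using dual_operations_subset(2)[OF d dd] by clarify (rule sym)
  have 4: "order_preserving P p \<longleftrightarrow> order_preserving Pd pd"
    using dual_order_preserving[OF d] dual_order_preserving[OF s] by (rule iffI)
  have 5: "idempotent_op P p \<longleftrightarrow> idempotent_op Pd pd"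
    using dual_idempotent[OF d] dual_idempotent[OF s] by (rule iffI)
  have 6: "closure_operation R P p \<longrightarrow> interior_operation R Pd pd"
    unfolding closure_operation_def interior_operation_def
    using dual_operationsD(2)[OF d] dual_intensive[OF d] 4 5 by simp
  have 7: "interior_operation R P p \<longrightarrow> closure_operation R Pd pd"
    unfolding closure_operation_def interior_operation_def
    using dual_operationsD(2)[OF d] dual_extensive[OF d] 4 5 by simp
  have 8: "restrictable R P p \<longleftrightarrow> surjection_functorial R Pd pd"
    using dual_surjection_functorial[OF d] dual_restrictable[OF s] by (rule iffI)
  have 9: "functorial R P p \<longleftrightarrow> functorial R Pd pd"
    if mono: "order_preserving P p" and closed: "closed_under_maps R P"
    using dual_functorial[OF d mono closed]
      dual_functorial[OF s dual_order_preserving[OF d mono] dual_closed_under_maps[OF d closed]]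
    by (rule iffI)
  show ?thesis
    using 1 2 dual_intensive[OF d] dual_extensive[OF d] 4 5 6[THEN mp] 7[THEN mp] 8 9
    by (intro conjI impI; (elim conjE)?; assumption?)
qed

end
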